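(* (a) If $\mathcal{P}=[m]\times[n]$ for $m,n\ge 2$, then $\dim I_T(\mathcal{P})=\dim A_T(\mathcal{P})=\mathrm{rk}(\mathcal{P})+1=n+m-1$. (b) If $\mathcal{P}=([n]\times[n])\backslash\mathfrak{S}_2$ for $n\ge 2$, then $\dim I_T(\mathcal{P})=\dim A_T(\mathcal{P})=\mathrm{rk}(\mathcal{P})+1=2n-1$. (c) If $\mathcal{P}=\Phi^+(A_n)$ for $n\ge 2$, then $\dim I_T(\mathcal{P})=\dim A_T(\mathcal{P})=\mathrm{rk}(\mathcal{P})+1=n$. (d) If $\mathcal{P}=\Phi^+(B_n)$ for $n\ge 2$, then $\dim I_T(\mathcal{P})=\dim A_T(\mathcal{P})=\mathrm{rk}(\mathcal{P})+1=2n-1$.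
   Context: The rank $\mathrm{rk}(\mathcal{P})$ of a finite poset is one less than the maximal cardinality of a chain. $\mathcal{J}(\mathcal{P})$ is the set of order ideals (down-closed subsets) of $\mathcal{P}$. For $p\in\mathcal{P}$ define real-valued functions on $\mathcal{J}(\mathcal{P})$: $\mathbf{1}_p(I)=1$ if $p\in I$ and $0$ otherwise; $\mathcal{T}_p^-(I)=1$ if $p$ is a maximal element of $I$ and $0$ otherwise; $\mathcal{T}_p^+(I)=1$ if $p\notin I$ and $I\cup\{p\}\in\mathcal{J}(\mathcal{P})$, and $0$ otherwise; $\mathcal{T}_p=\mathcal{T}_p^+-\mathcal{T}_p^-$. The toggleability spaces are the real vector spaces $I_T(\mathcal{P})=\mathrm{Span}_{\mathbb{R}}(\mathbf{1}_p\mid p\in\mathcal{P})\cap\mathrm{Span}_{\mathbb{R}}(\{1\}\cup\{\mathcal{T}_p\mid p\in\mathcal{P}\})$ and $A_T(\mathcal{P})=\mathrm{Span}_{\mathbb{R}}(\mathcal{T}_p^-\mid p\in\mathcal{P})\cap\mathrm{Span}_{\mathbb{R}}(\{1\}\cup\{\mathcal{T}_p\mid p\in\mathcal{P}\})$, where $1$ is the constant function. All four families are sets of integer pairs ordered componentwise ($(i,j)\preceq(k,\ell)$ iff $i\le k$ and $j\le\ell$): - $[m]\times[n]=\{(i,j): 1\le i\le m,\ 1\le j\le n\}$; - $([n]\times[n])\backslash\mathfrak{S}_2=\{(i,j):1\le i\le j\le n\}$; - $\Phi^+(A_n)=\{(i,j):1\le i,j\le n,\ i+j\ge n+1\}$;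 - $\Phi^+(B_n)=\{(i,j):1\le j\le i\le 2n-1,\ i+j\ge 2n\}$. *)

theory Defs
  imports
    Complex_Main
    "HOL-Library.Function_Algebras"
    "HOL-Library.Indicator_Function"
    "HOL-Library.Product_Order"
begin

text \<open>
  A finite poset is a finite subset \<open>P\<close> of a type of class \<open>order\<close>, with the induced order.
\<close>

definition poset_rank :: "'a::order set \<Rightarrow> int"
  where "poset_rank P =
    int (Max {card C |C. C \<subseteq> P \<and> Complete_Partial_Order.chain (\<le>) C}) - 1"

definition order_ideals :: "'a::order set \<Rightarrow> 'a set set"
  where "order_ideals P = {I. I \<subseteq> P \<and> (\<forall>x\<in>I. \<forall>y\<in>P. y \<le> x \<longrightarrow> y \<in> I)}"

text \<open>
  A real-valued function on \<open>order_ideals P\<close> is encoded as a function of type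
  \<open>'a set \<Rightarrow> real\<close> that vanishes outside \<open>order_ideals P\<close>. In particular the constant
  function \<open>1\<close> is \<open>indicator (order_ideals P)\<close>. On functions of this form, linear
  (in)dependence on \<open>order_ideals P\<close> and on the whole type agree.
\<close>

definition ideal_ind :: "'a::order set \<Rightarrow> 'a \<Rightarrow> 'a set \<Rightarrow> real"
  where "ideal_ind P p = indicator {I \<in> order_ideals P. p \<in> I}"

definition toggle_out :: "'a::order set \<Rightarrow> 'a \<Rightarrow> 'a set \<Rightarrow> real"
  where "toggle_out P p =
    indicator {I \<in> order_ideals P. p \<in> I \<and> (\<forall>q\<in>I. \<not> p < q)}"

definition toggle_in :: "'a::order set \<Rightarrow> 'a \<Rightarrow> 'a set \<Rightarrow> real"
  where "toggle_in P p =
    indicator {I \<in> order_ideals P. p \<notin> I \<and> I \<union> {p} \<in> order_ideals P}"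

definition toggleability :: "'a::order set \<Rightarrow> 'a \<Rightarrow> 'a set \<Rightarrow> real"
  where "toggleability P p = toggle_in P p - toggle_out P p"

text \<open>
  The library has no \<open>real_vector\<close> instance for function types, so the pointwise real vector
  space structure is an interpretation of the locale \<open>vector_space\<close>; addition and zero are
  those of \<open>HOL-Library.Function_Algebras\<close>.
\<close>

definition fun_scale :: "real \<Rightarrow> ('b \<Rightarrow> real) \<Rightarrow> 'b \<Rightarrow> real"
  where "fun_scale c f = (\<lambda>x. c * f x)"

global_interpretation fun_space: vector_space fun_scale
  by unfold_locales (auto simp: fun_scale_def fun_eq_iff algebra_simps)

definition toggle_span :: "'a::order set \<Rightarrow> ('a set \<Rightarrow> real) set"
  where "toggle_span P = fun_space.span ({indicator (order_ideals P)} \<union> toggleability P ` P)"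

definition I_T :: "'a::order set \<Rightarrow> ('a set \<Rightarrow> real) set"
  where "I_T P = fun_space.span (ideal_ind P ` P) \<inter> toggle_span P"

definition A_T :: "'a::order set \<Rightarrow> ('a set \<Rightarrow> real) set"
  where "A_T P = fun_space.span (toggle_out P ` P) \<inter> toggle_span P"

text \<open>
  The order on \<open>int \<times> int\<close> is the componentwise one of \<open>HOL-Library.Product_Order\<close>.
\<close>

definition rectangle :: "nat \<Rightarrow> nat \<Rightarrow> (int \<times> int) set"
  where "rectangle m n = {(i, j). 1 \<le> i \<and> i \<le> int m \<and> 1 \<le> j \<and> j \<le> int n}"

definition shifted_staircase :: "nat \<Rightarrow> (int \<times> int) set"
  where "shifted_staircase n = {(i, j). 1 \<le> i \<and> i \<le> j \<and> j \<le> int n}"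

definition root_poset_A :: "nat \<Rightarrow> (int \<times> int) set"
  where "root_poset_A n =
    {(i, j). 1 \<le> i \<and> i \<le> int n \<and> 1 \<le> j \<and> j \<le> int n \<and> i + j \<ge> int n + 1}"

definition root_poset_B :: "nat \<Rightarrow> (int \<times> int) set"
  where "root_poset_B n =
    {(i, j). 1 \<le> j \<and> j \<le> i \<and> i \<le> 2 * int n - 1 \<and> i + j \<ge> 2 * int n}"

end

theory Submission
  imports Defs
begin

text \<open>
  A combination \<open>\<Sum> d\<^sub>p T\<^sup>+\<^sub>p - \<Sum> e\<^sub>p T\<^sup>-\<^sub>p - \<Sum> c\<^sub>p 1\<^sub>p\<close> is constant on the order ideals iff adding any
  single element to any ideal does not change it. In a poset cut out of the integer grid, only the two
  incomparable neighbours of \<open>p = (i, j)\<close>, at \<open>(i - 1, j + 1)\<close> and \<open>(i + 1, j - 1)\<close>, influence the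
  increment at \<open>p\<close>, and they can be prescribed independently, which gives finitely many local linear
  equations in \<open>c\<close>, \<open>d\<close>, \<open>e\<close>.

  For \<open>I_T\<close> one has \<open>e = d\<close> with \<open>c\<close> free, and the equations say that \<open>d\<close> agrees at the bottom and the
  top of every unit square, a missing bottom counting as \<open>0\<close>: one parameter for each diagonal that
  starts in rank \<open>0\<close>, except that on a boundary diagonal of a shifted shape all values are free. For
  \<open>A_T\<close> one has \<open>c = 0\<close>, and \<open>d (i, j) = u (i, j)\<close>, \<open>e (i, j) = u (i + 1, j + 1)\<close> for a function \<open>u\<close>
  whose mixed second differences vanish, so \<open>u (i, j) = \<alpha> i + \<beta> j\<close>, with corrections on a boundary
  diagonal and with \<open>u = 0\<close> just outside the corners; the remaining parameters can be read as one
  sequence supported on an interval.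

  The parameters are determined by the function because the toggleabilities are linearly
  independent modulo constants: pair \<open>\<Sum> d\<^sub>p T\<^sub>p\<close> with \<open>\<Sum> d\<^sub>p 1\<^sub>p\<close> over all ideals.
\<close>

section \<open>Functions on order ideals\<close>

lemma sum_apply: "sum g A x = (\<Sum>a\<in>A. g a x)"
  for g :: "'a \<Rightarrow> 'b \<Rightarrow> real"
  by (induction A rule: infinite_finite_induct) auto

text \<open>Coefficients are indexed by \<open>P\<close> rather than by the image, so nothing is
  assumed about injectivity of \<open>F\<close>.\<close>

lemma span_image_iff:
  fixes F :: "'a \<Rightarrow> 'b \<Rightarrow> real"
  assumes "finite P"
  shows "f \<in> fun_space.span (F ` P) \<longleftrightarrow> (\<exists>c. f = (\<lambda>I. \<Sum>p\<in>P. c p * F p I))"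
proof
  let ?V = "{f. \<exists>c. f = (\<lambda>I. \<Sum>p\<in>P. c p * F p I)}"
  have "fun_space.subspace ?V"
  proof (rule fun_space.subspaceI)
    show "0 \<in> ?V"
      by (auto simp: fun_eq_iff intro!: exI[of _ "\<lambda>_. 0"])
  next
    fix f g assume "f \<in> ?V" "g \<in> ?V"
    then obtain c d where "f = (\<lambda>I. \<Sum>p\<in>P. c p * F p I)" "g = (\<lambda>I. \<Sum>p\<in>P. d p * F p I)"
      by auto
    then show "f + g \<in> ?V"
      by (auto simp: fun_eq_iff sum.distrib algebra_simps intro!: exI[of _ "\<lambda>p. c p + d p"])
  next
    fix r f assume "f \<in> ?V"
    then obtain c where "f = (\<lambda>I. \<Sum>p\<in>P. c p * F p I)"
      by auto
    then show "fun_scale r f \<in> ?V"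
      by (auto simp: fun_eq_iff fun_scale_def sum_distrib_left mult.assoc
          intro!: exI[of _ "\<lambda>p. r * c p"])
  qed
  moreover have "F ` P \<subseteq> ?V"
  proof
    fix g assume "g \<in> F ` P"
    then obtain p where "p \<in> P" "g = F p" by auto
    moreover have "(\<Sum>q\<in>P. (if q = p then 1 else 0) * F q I) = (\<Sum>q\<in>P. if q = p then F q I else 0)" for I
      by (rule sum.cong) auto
    ultimately show "g \<in> ?V"
      using assms by (auto simp: fun_eq_iff intro!: exI[of _ "\<lambda>q. if q = p then 1 else 0"])
  qed
  ultimately have "fun_space.span (F ` P) \<subseteq> ?V"
    by (rule fun_space.span_minimal[rotated])
  then show "f \<in> fun_space.span (F ` P) \<Longrightarrow> \<exists>c. f = (\<lambda>I. \<Sum>p\<in>P. c p * F p I)"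
    by auto
next
  assume "\<exists>c. f = (\<lambda>I. \<Sum>p\<in>P. c p * F p I)"
  then obtain c where "f = (\<lambda>I. \<Sum>p\<in>P. c p * F p I)" by auto
  then have "f = (\<Sum>p\<in>P. fun_scale (c p) (F p))"
    by (auto simp: fun_eq_iff sum_apply fun_scale_def)
  then show "f \<in> fun_space.span (F ` P)"
    by (simp add: fun_space.span_sum fun_space.span_scale fun_space.span_base)
qed

text \<open>\<open>V\<close> is the injective linear image of the coordinate space of
  \<open>K\<close>, encoded as the functions that vanish off \<open>K\<close>; the unit vectors form
  a basis there. Each dimension count is reduced to an explicit parametrization by this
  lemma.\<close>

lemma dim_eq_card_if_parametrized:
  fixes \<Phi> :: "('k \<Rightarrow> real) \<Rightarrow> 'b \<Rightarrow> real"
  assumes fin: "finite K"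
    and add: "\<And>x y. \<Phi> (\<lambda>k. x k + y k) = (\<lambda>b. \<Phi> x b + \<Phi> y b)"
    and scale: "\<And>r x. \<Phi> (\<lambda>k. r * x k) = (\<lambda>b. r * \<Phi> x b)"
    and inj: "\<And>x. (\<forall>k. k \<notin> K \<longrightarrow> x k = 0) \<Longrightarrow> \<Phi> x = (\<lambda>_. 0) \<Longrightarrow> x = (\<lambda>_. 0)"
    and V: "V = \<Phi> ` {x. \<forall>k. k \<notin> K \<longrightarrow> x k = 0}"
  shows "fun_space.dim V = card K"
proof -
  interpret vector_space_pair "fun_scale :: real \<Rightarrow> ('k \<Rightarrow> real) \<Rightarrow> _" "fun_scale :: real \<Rightarrow> ('b \<Rightarrow> real) \<Rightarrow> _"
    by unfold_locales
  have lin: "Vector_Spaces.linear fun_scale fun_scale \<Phi>"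
    unfolding Vector_Spaces.linear_iff fun_scale_def[abs_def] plus_fun_def
    by (simp add: add scale fun_space.vector_space_axioms[unfolded fun_scale_def[abs_def]])
  define \<delta> :: "'k \<Rightarrow> 'k \<Rightarrow> real" where "\<delta> k = (\<lambda>l. if l = k then 1 else 0)" for k
  have inj_\<delta>: "inj_on \<delta> A" for A
    by (auto simp: inj_on_def \<delta>_def fun_eq_iff split: if_splits)
  have expand: "(\<Sum>p\<in>K. c p * \<delta> p k) = (if k \<in> K then c k else 0)" for c k
  proof -
    have "(\<Sum>p\<in>K. c p * \<delta> p k) = (\<Sum>p\<in>K. if k = p then c p else 0)"
      by (rule sum.cong) (auto simp: \<delta>_def)
    then show ?thesis using fin by simp
  qed
  let ?W = "{x. \<forall>k. k \<notin> K \<longrightarrow> x k = (0::real)}"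
  have span: "fun_space.span (\<delta> ` K) = ?W"
  proof (intro set_eqI)
    fix x
    have "(\<exists>c. x = (\<lambda>k. \<Sum>p\<in>K. c p * \<delta> p k)) \<longleftrightarrow> x \<in> ?W"
      unfolding expand by (auto intro!: exI[of _ x])
    then show "x \<in> fun_space.span (\<delta> ` K) \<longleftrightarrow> x \<in> ?W"
      using span_image_iff[OF fin, of x \<delta>] by simp
  qed
  have indep: "fun_space.independent (\<delta> ` K)"
  proof (rule fun_space.independent_if_scalars_zero)
    fix c v assume 0: "(\<Sum>x\<in>\<delta> ` K. fun_scale (c x) x) = 0" and "v \<in> \<delta> ` K"
    then obtain k where k: "k \<in> K" "v = \<delta> k" by auto
    have "(\<Sum>x\<in>\<delta> ` K. fun_scale (c x) x) k = (\<Sum>p\<in>K. c (\<delta> p) * \<delta> p k)"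
      by (simp add: sum.reindex[OF inj_\<delta>] sum_apply fun_scale_def)
    then show "c v = 0"
      using 0 k expand[of "c \<circ> \<delta>" k] by simp
  qed (use fin in auto)
  have "inj_on \<Phi> ?W"
  proof (rule inj_onI)
    fix x y assume xy: "x \<in> ?W" "y \<in> ?W" "\<Phi> x = \<Phi> y"
    \<comment> \<open>The hypothesis \<open>inj\<close> controls the kernel only; the difference of
      \<open>x\<close> and \<open>y\<close> is formed from \<open>add\<close> and from
      \<open>scale\<close> with factor \<open>- 1\<close>.\<close>
    have "\<Phi> (\<lambda>k. x k + (- 1) * y k) = (\<lambda>b. \<Phi> x b + (- 1) * \<Phi> y b)"
      unfolding add scale by simp
    then have "\<Phi> (\<lambda>k. x k - y k) = (\<lambda>_. 0)"
      using xy by simp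
    then have "(\<lambda>k. x k - y k) = (\<lambda>_. 0)"
      using xy by (intro inj) auto
    then show "x = y" by (simp add: fun_eq_iff)
  qed
  then have "fun_space.independent (\<Phi> ` \<delta> ` K)"
    using linear_independent_injective_image[OF lin indep] span by simp
  moreover have "fun_space.span (\<Phi> ` \<delta> ` K) = V"
    using linear_span_image[OF lin, of "\<delta> ` K"] span V by simp
  then have "fun_space.span (\<Phi> ` \<delta> ` K) = fun_space.span V"
    by (metis fun_space.span_span)
  ultimately have "fun_space.dim V = card (\<Phi> ` \<delta> ` K)"
    by (intro fun_space.dim_eq_card)
  also have "\<dots> = card (\<delta> ` K)"
    using \<open>inj_on \<Phi> ?W\<close> span fun_space.span_superset[of "\<delta> ` K"]
    by (intro card_image) (metis inj_on_subset)
  also have "\<dots> = card K" by (rule card_image[OF inj_\<delta>])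
  finally show ?thesis .
qed

section \<open>Order ideals and independence of the toggle functions\<close>

lemma finite_order_ideals: "finite P \<Longrightarrow> finite (order_ideals P)"
  by (rule finite_subset[of _ "Pow P"]) (auto simp: order_ideals_def)

lemma empty_order_ideal: "{} \<in> order_ideals P"
  by (auto simp: order_ideals_def)

lemma strict_down_set_addable:
  assumes "p \<in> P"
  shows "{q \<in> P. q < p} \<in> order_ideals P" "insert p {q \<in> P. q < p} \<in> order_ideals P"
  using assms by (auto simp: order_ideals_def less_le)

lemma order_ideal_remove_maximal:
  assumes "I \<in> order_ideals P" "p \<in> I" "\<forall>q\<in>I. \<not> p < q"
  shows "I - {p} \<in> order_ideals P"
  unfolding order_ideals_def
proof (safe, goal_cases)
  case (1 x)
  then show ?case
    using assms(1) by (auto simp: order_ideals_def)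
next
  case (2 x y)
  then show ?case using assms(1) by (auto simp: order_ideals_def)
next
  case (3 x y)
  then show ?case using assms(3) by (auto simp: less_le)
qed

lemma maximal_of_addable:
  assumes "I \<in> order_ideals P" "p \<in> P" "p \<notin> I" "q \<in> insert p I"
  shows "\<not> p < q"
  using assms by (auto simp: order_ideals_def dest: less_imp_le)

text \<open>Removing maximal elements one by one leads from any ideal down to the empty one.\<close>

lemma toggle_invariant_imp_constant:
  fixes F :: "'a::order set \<Rightarrow> 'b"
  assumes fin: "finite P"
    and step: "\<And>p I. \<lbrakk>p \<in> P; p \<notin> I; I \<in> order_ideals P; insert p I \<in> order_ideals P\<rbrakk>
                 \<Longrightarrow> F (insert p I) = F I"
    and I: "I \<in> order_ideals P"
  shows "F I = F {}"
  using I
proof (induction "card I" arbitrary: I)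
  case 0
  then have "finite I" using fin by (auto simp: order_ideals_def intro: finite_subset)
  then show ?case using 0 by simp
next
  case (Suc n)
  then have "finite I" "I \<noteq> {}" using fin by (auto simp: order_ideals_def intro: finite_subset)
  then obtain p where p: "p \<in> I" "\<forall>q\<in>I. p \<le> q \<longrightarrow> q = p"
    using finite_has_maximal by metis
  then have J: "I - {p} \<in> order_ideals P"
    using Suc.prems by (intro order_ideal_remove_maximal) auto
  have ins: "insert p (I - {p}) = I" using p(1) by blast
  have "p \<in> P" using Suc.prems p(1) unfolding order_ideals_def by blast
  then have "F I = F (I - {p})"
    using step[of p "I - {p}"] ins J Suc.prems by simp
  also have "\<dots> = F {}"
    using Suc.hyps(1)[OF _ J] Suc.hyps(2) p(1) \<open>finite I\<close> by simp
  finally show ?case .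
qed

text \<open>Toggling \<open>p\<close> matches the ideals to which \<open>p\<close> can be added with those from which it can be removed.\<close>
lemma sum_mult_toggleability:
  fixes f :: "'a::order set \<Rightarrow> real"
  assumes fin: "finite P" and p: "p \<in> P"
  shows "(\<Sum>I\<in>order_ideals P. f I * toggleability P p I) =
    (\<Sum>I | I \<in> order_ideals P \<and> p \<notin> I \<and> insert p I \<in> order_ideals P. f I - f (insert p I))"
proof -
  let ?J = "order_ideals P"
  let ?A = "{I. I \<in> ?J \<and> p \<notin> I \<and> insert p I \<in> ?J}"
  let ?R = "{I. I \<in> ?J \<and> p \<in> I \<and> (\<forall>q\<in>I. \<not> p < q)}"
  have finJ: "finite ?J" using fin by (rule finite_order_ideals)
  have "(\<Sum>I\<in>?J. f I * toggle_in P p I) = (\<Sum>I\<in>?A. f I)"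
    by (simp add: toggle_in_def sum_mult_indicator[OF finJ]) (rule sum.cong, auto)
  moreover have "(\<Sum>I\<in>?J. f I * toggle_out P p I) = (\<Sum>I\<in>?R. f I)"
    by (simp add: toggle_out_def sum_mult_indicator[OF finJ]) (rule sum.cong, auto)
  moreover have "(\<Sum>I\<in>?R. f I) = (\<Sum>I\<in>?A. f (insert p I))"
  proof (rule sum.reindex_bij_witness[of _ "insert p" "\<lambda>I. I - {p}"])
    fix I assume "I \<in> ?A"
    then show "insert p I \<in> ?R"
      using maximal_of_addable[of I P p] p by auto
  qed (auto intro: order_ideal_remove_maximal simp: insert_absorb)
  ultimately show ?thesis
    by (simp add: toggleability_def right_diff_distrib sum_subtractf)
qed

text \<open>Pairing with the constant \<open>1\<close> shows \<open>a = 0\<close>, because every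
  toggleability sums to zero over the ideals. Pairing with \<open>?f\<close>, the sum of
  \<open>d q\<close> over the elements \<open>q\<close> of an ideal, then gives a vanishing sum of
  squares of the \<open>d q\<close>, weighted by the number of ideals to which \<open>q\<close> can
  be added.\<close>

lemma toggleabilities_independent:
  fixes d :: "'a::order \<Rightarrow> real"
  assumes fin: "finite P"
    and const: "\<And>I. I \<in> order_ideals P \<Longrightarrow> (\<Sum>p\<in>P. d p * toggleability P p I) = a"
    and p: "p \<in> P"
  shows "d p = 0"
proof -
  let ?J = "order_ideals P"
  let ?A = "\<lambda>p. {I. I \<in> ?J \<and> p \<notin> I \<and> insert p I \<in> ?J}"
  let ?f = "\<lambda>I. \<Sum>q\<in>P. if q \<in> I then d q else 0"
  have finJ: "finite ?J" using fin by (rule finite_order_ideals)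
  have swap: "(\<Sum>I\<in>?J. g I * a) = (\<Sum>p\<in>P. d p * (\<Sum>I\<in>?J. g I * toggleability P p I))" for g
  proof -
    have "(\<Sum>I\<in>?J. g I * a) = (\<Sum>I\<in>?J. \<Sum>p\<in>P. d p * (g I * toggleability P p I))"
      by (rule sum.cong) (simp_all add: const[symmetric] sum_distrib_left mult_ac)
    also have "\<dots> = (\<Sum>p\<in>P. d p * (\<Sum>I\<in>?J. g I * toggleability P p I))"
      by (subst sum.swap) (simp add: sum_distrib_left)
    finally show ?thesis .
  qed
  have "(\<Sum>I\<in>?J. 1 * a) = 0"
    unfolding swap by (simp add: sum_mult_toggleability[OF fin, of _ "\<lambda>_. 1", simplified])
  moreover have "?J \<noteq> {}" using empty_order_ideal by blast
  ultimately have "a = 0" using finJ by simp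
  have step: "?f I - ?f (insert q I) = - d q" if "q \<in> P" "I \<in> ?A q" for q I
  proof -
    have "?f (insert q I) - ?f I = (\<Sum>r\<in>P. if r = q then d r else 0)"
      unfolding sum_subtractf[symmetric] using that by (intro sum.cong) auto
    then show ?thesis using that fin by simp
  qed
  have "(\<Sum>I\<in>?J. ?f I * toggleability P q I) = - (d q * card (?A q))" if "q \<in> P" for q
    unfolding sum_mult_toggleability[OF fin that] using step[OF that] by simp
  then have "(\<Sum>q\<in>P. d q * - (d q * card (?A q))) = (\<Sum>I\<in>?J. ?f I * a)"
    unfolding swap by (intro sum.cong) auto
  then have "(\<Sum>q\<in>P. card (?A q) * (d q)\<^sup>2) = 0"
    using \<open>a = 0\<close> by (simp add: sum_negf power2_eq_square mult_ac)
  then have "card (?A p) * (d p)\<^sup>2 = 0"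
    using p fin by (subst (asm) sum_nonneg_eq_0_iff) auto
  \<comment> \<open>The strict down-set of \<open>p\<close> is an ideal to which \<open>p\<close>
    can be added, so the weight is positive.\<close>
  moreover have "card (?A p) \<noteq> 0"
    using finJ strict_down_set_addable[OF p] by (auto simp: card_eq_0_iff)
  ultimately show ?thesis by simp
qed

text \<open>Evaluation at the principal ideal of \<open>p\<close> isolates \<open>c p\<close>, since
  \<open>p\<close> is its only maximal element.\<close>

lemma toggle_outs_independent:
  fixes c :: "'a::order \<Rightarrow> real"
  assumes fin: "finite P"
    and zero: "\<And>I. I \<in> order_ideals P \<Longrightarrow> (\<Sum>p\<in>P. c p * toggle_out P p I) = 0"
    and p: "p \<in> P"
  shows "c p = 0"
proof -
  let ?I = "insert p {q \<in> P. q < p}"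
  have "(\<Sum>q\<in>P. c q * toggle_out P q ?I) = (\<Sum>q\<in>P. if q = p then c q else 0)"
    using strict_down_set_addable[OF p]
    by (intro sum.cong) (auto simp: toggle_out_def indicator_def)
  then show ?thesis
    using zero[OF strict_down_set_addable(2)[OF p]] p fin by simp
qed

lemma toggle_span_iff:
  assumes "finite P"
  shows "f \<in> toggle_span P \<longleftrightarrow> (\<exists>a d. f = (\<lambda>I. a * indicator (order_ideals P) I
    + (\<Sum>p\<in>P. d p * toggleability P p I)))"
  unfolding toggle_span_def insert_is_Un[symmetric] fun_space.span_insert mem_Collect_eq
    span_image_iff[OF assms]
  by (auto simp: fun_eq_iff fun_scale_def algebra_simps)

section \<open>Posets in the integer grid\<close>

text \<open>Covering relations are unit steps: from either of two comparable elements, a unit step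
  inside \<open>P\<close> leads towards the other. Addability and maximality can therefore be tested
  at adjacent grid points.\<close>

locale grid_poset =
  fixes P :: "(int \<times> int) set"
  assumes finite: "finite P"
    and below: "\<lbrakk>(i, j) \<in> P; (k, l) \<in> P; (k, l) < (i, j)\<rbrakk>
      \<Longrightarrow> (i - 1, j) \<in> P \<and> (k, l) \<le> (i - 1, j) \<or> (i, j - 1) \<in> P \<and> (k, l) \<le> (i, j - 1)"
    and above: "\<lbrakk>(i, j) \<in> P; (k, l) \<in> P; (i, j) < (k, l)\<rbrakk>
      \<Longrightarrow> (i + 1, j) \<in> P \<and> (i + 1, j) \<le> (k, l) \<or> (i, j + 1) \<in> P \<and> (i, j + 1) \<le> (k, l)"
begin

lemma order_ideal_down:
  assumes "I \<in> order_ideals P" "q \<in> I" "p \<in> P" "p \<le> q"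
  shows "p \<in> I"
  using assms by (auto simp: order_ideals_def)

lemma order_ideal_subset: "I \<in> order_ideals P \<Longrightarrow> p \<in> I \<Longrightarrow> p \<in> P"
  by (auto simp: order_ideals_def)

lemma addable_iff:
  assumes I: "I \<in> order_ideals P" and q: "(i, j) \<in> P" "(i, j) \<notin> I"
  shows "insert (i, j) I \<in> order_ideals P \<longleftrightarrow>
    ((i - 1, j) \<in> P \<longrightarrow> (i - 1, j) \<in> I) \<and> ((i, j - 1) \<in> P \<longrightarrow> (i, j - 1) \<in> I)"
proof
  assume J: "insert (i, j) I \<in> order_ideals P"
  show "((i - 1, j) \<in> P \<longrightarrow> (i - 1, j) \<in> I) \<and> ((i, j - 1) \<in> P \<longrightarrow> (i, j - 1) \<in> I)"
    using order_ideal_down[OF J, of "(i, j)" "(i - 1, j)"]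
      order_ideal_down[OF J, of "(i, j)" "(i, j - 1)"] by auto
next
  assume covers: "((i - 1, j) \<in> P \<longrightarrow> (i - 1, j) \<in> I) \<and> ((i, j - 1) \<in> P \<longrightarrow> (i, j - 1) \<in> I)"
  have "p \<in> insert (i, j) I" if "p \<in> P" "p \<le> (i, j)" for p
  proof (cases "p = (i, j)")
    case False
    then have "p < (i, j)" using that by (simp add: order_less_le)
    then have "(i - 1, j) \<in> P \<and> p \<le> (i - 1, j) \<or> (i, j - 1) \<in> P \<and> p \<le> (i, j - 1)"
      using below[of i j "fst p" "snd p"] q that by simp
    then have "p \<in> I"
      using covers order_ideal_down[OF I _ \<open>p \<in> P\<close>] by blast
    then show ?thesis by simp
  qed simp
  then show "insert (i, j) I \<in> order_ideals P"
    using I q by (auto simp: order_ideals_def)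
qed

lemma maximal_iff:
  assumes I: "I \<in> order_ideals P" and q: "(i, j) \<in> I"
  shows "(\<forall>p\<in>I. \<not> (i, j) < p) \<longleftrightarrow> (i + 1, j) \<notin> I \<and> (i, j + 1) \<notin> I"
proof
  assume max: "\<forall>p\<in>I. \<not> (i, j) < p"
  have "(i, j) < (i + 1, j)" "(i, j) < (i, j + 1)"
    by (simp_all add: order_less_le)
  then show "(i + 1, j) \<notin> I \<and> (i, j + 1) \<notin> I" using max by blast
next
  assume covers: "(i + 1, j) \<notin> I \<and> (i, j + 1) \<notin> I"
  show "\<forall>p\<in>I. \<not> (i, j) < p"
  proof (intro ballI notI)
    fix p assume "p \<in> I" "(i, j) < p"
    then have "(i + 1, j) \<in> P \<and> (i + 1, j) \<le> p \<or> (i, j + 1) \<in> P \<and> (i, j + 1) \<le> p"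
      using above[of i j "fst p" "snd p"] q order_ideal_subset[OF I] by simp
    then show False
      using covers order_ideal_down[OF I \<open>p \<in> I\<close>] by blast
  qed
qed

section \<open>Increments of toggle combinations\<close>

lemma toggle_in_eq:
  assumes "I \<in> order_ideals P" "(i, j) \<in> P"
  shows "toggle_in P (i, j) I = of_bool ((i, j) \<notin> I \<and>
    ((i - 1, j) \<in> P \<longrightarrow> (i - 1, j) \<in> I) \<and> ((i, j - 1) \<in> P \<longrightarrow> (i, j - 1) \<in> I))"
  using assms addable_iff[OF assms] by (auto simp: toggle_in_def indicator_def)

lemma toggle_out_eq:
  assumes "I \<in> order_ideals P"
  shows "toggle_out P (i, j) I =
    of_bool ((i, j) \<in> I \<and> (i + 1, j) \<notin> I \<and> (i, j + 1) \<notin> I)"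
  using assms maximal_iff[OF assms] by (auto simp: toggle_out_def indicator_def)

text \<open>Separate coefficients for adding and removing let one computation serve both spaces:
  \<open>I_T\<close> takes \<open>e = d\<close>, and for \<open>A_T\<close> the difference
  \<open>e - d\<close> carries the coefficients of the \<open>toggle_out\<close>.\<close>

definition toggle_comb :: "(int \<times> int \<Rightarrow> real) \<Rightarrow> (int \<times> int \<Rightarrow> real) \<Rightarrow> (int \<times> int) set \<Rightarrow> real"
  where "toggle_comb d e I = (\<Sum>q\<in>P. d q * toggle_in P q I) - (\<Sum>q\<in>P. e q * toggle_out P q I)"

text \<open>Adding \<open>p = (i, j)\<close> changes \<open>toggle_in\<close> only at
  \<open>p\<close> and its upper neighbours, and \<open>toggle_out\<close> only at \<open>p\<close>
  and its lower neighbours. The element \<open>(i, j + 1)\<close> becomes addable iff its other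
  lower neighbour \<open>(i - 1, j + 1)\<close> is present or missing from \<open>P\<close>, and
  \<open>(i - 1, j)\<close> stops being maximal iff \<open>(i - 1, j + 1)\<close> is absent. The
  other corner acts symmetrically. Since \<open>d\<close> and \<open>e\<close> vanish outside
  \<open>P\<close>, missing neighbours contribute nothing.\<close>

lemma toggle_comb_insert:
  assumes I: "I \<in> order_ideals P" and J: "insert (i, j) I \<in> order_ideals P"
    and p: "(i, j) \<in> P" "(i, j) \<notin> I"
    and supp: "\<And>q. q \<notin> P \<Longrightarrow> d q = 0" "\<And>q. q \<notin> P \<Longrightarrow> e q = 0"
  shows "toggle_comb d e (insert (i, j) I) - toggle_comb d e I =
    d (i, j + 1) * of_bool ((i - 1, j + 1) \<in> P \<longrightarrow> (i - 1, j + 1) \<in> I)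
    + d (i + 1, j) * of_bool ((i + 1, j - 1) \<in> P \<longrightarrow> (i + 1, j - 1) \<in> I)
    + e (i - 1, j) * of_bool ((i - 1, j + 1) \<notin> I)
    + e (i, j - 1) * of_bool ((i + 1, j - 1) \<notin> I) - d (i, j) - e (i, j)"
proof -
  \<comment> \<open>Since \<open>p\<close> is absent from the ideal \<open>I\<close> and can be
    added to it, its upper neighbours are absent and its lower neighbours in \<open>P\<close> are
    present.\<close>
  have N: "(i, j + 1) \<notin> I" "(i + 1, j) \<notin> I"
    using order_ideal_down[OF I _ p(1), of "(i, j + 1)"] order_ideal_down[OF I _ p(1), of "(i + 1, j)"] p
    by auto
  have W: "(i - 1, j) \<in> I" if "(i - 1, j) \<in> P"
    using order_ideal_down[OF J _ that, of "(i, j)"] by simp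
  have S: "(i, j - 1) \<in> I" if "(i, j - 1) \<in> P"
    using order_ideal_down[OF J _ that, of "(i, j)"] by simp
  let ?nw = "of_bool ((i - 1, j + 1) \<in> P \<longrightarrow> (i - 1, j + 1) \<in> I) :: real"
  let ?se = "of_bool ((i + 1, j - 1) \<in> P \<longrightarrow> (i + 1, j - 1) \<in> I) :: real"
  have "d q * (toggle_in P q (insert (i, j) I) - toggle_in P q I) =
     (if q = (i, j + 1) then d q * ?nw else 0) + (if q = (i + 1, j) then d q * ?se else 0)
     - (if q = (i, j) then d q else 0)" if "q \<in> P" for q
  proof -
    obtain k l where q: "q = (k, l)" by (cases q)
    show ?thesis
      using that p N W S unfolding q
      by (auto simp: toggle_in_eq[OF J] toggle_in_eq[OF I])
  qed
  then have "(\<Sum>q\<in>P. d q * (toggle_in P q (insert (i, j) I) - toggle_in P q I)) =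
     (\<Sum>q\<in>P. (if q = (i, j + 1) then d q * ?nw else 0) + (if q = (i + 1, j) then d q * ?se else 0)
     - (if q = (i, j) then d q else 0))"
    by (rule sum.cong[OF refl])
  also have "\<dots> = d (i, j + 1) * ?nw + d (i + 1, j) * ?se - d (i, j)"
    using finite p by (simp add: sum.distrib sum_subtractf supp)
  finally have D: "(\<Sum>q\<in>P. d q * (toggle_in P q (insert (i, j) I) - toggle_in P q I)) = \<dots>" .
  let ?nw' = "of_bool ((i - 1, j + 1) \<notin> I) :: real"
  let ?se' = "of_bool ((i + 1, j - 1) \<notin> I) :: real"
  have "e q * (toggle_out P q (insert (i, j) I) - toggle_out P q I) =
     (if q = (i, j) then e q else 0) - (if q = (i - 1, j) then e q * ?nw' else 0)
     - (if q = (i, j - 1) then e q * ?se' else 0)" if "q \<in> P" for q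
  proof -
    obtain k l where q: "q = (k, l)" by (cases q)
    show ?thesis
      using that p N W S unfolding q
      by (auto simp: toggle_out_eq[OF J] toggle_out_eq[OF I])
  qed
  then have "(\<Sum>q\<in>P. e q * (toggle_out P q (insert (i, j) I) - toggle_out P q I)) =
     (\<Sum>q\<in>P. (if q = (i, j) then e q else 0) - (if q = (i - 1, j) then e q * ?nw' else 0)
     - (if q = (i, j - 1) then e q * ?se' else 0))"
    by (rule sum.cong[OF refl])
  also have "\<dots> = e (i, j) - e (i - 1, j) * ?nw' - e (i, j - 1) * ?se'"
    using finite p by (simp add: sum.distrib sum_subtractf supp)
  finally have E: "(\<Sum>q\<in>P. e q * (toggle_out P q (insert (i, j) I) - toggle_out P q I)) = \<dots>" .
  show ?thesis
    using D E by (simp add: toggle_comb_def right_diff_distrib sum_subtractf)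
qed

text \<open>
  Increment of the combination when \<open>p = (i, j)\<close> is added to an ideal: the presence of the two
  incomparable neighbours \<open>(i - 1, j + 1)\<close> and \<open>(i + 1, j - 1)\<close> of \<open>p\<close> must not matter, and the
  total increment must be \<open>c p\<close>.
\<close>
definition balanced :: "(int \<times> int \<Rightarrow> real) \<Rightarrow> (int \<times> int \<Rightarrow> real) \<Rightarrow> (int \<times> int \<Rightarrow> real) \<Rightarrow> bool"
  where "balanced d e c \<longleftrightarrow> (\<forall>i j. (i, j) \<in> P \<longrightarrow>
    ((i - 1, j + 1) \<in> P \<longrightarrow> d (i, j + 1) = e (i - 1, j)) \<and>
    ((i + 1, j - 1) \<in> P \<longrightarrow> d (i + 1, j) = e (i, j - 1)) \<and>
    c (i, j) = d (i, j + 1) + (if (i - 1, j + 1) \<in> P then 0 else e (i - 1, j))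
      + d (i + 1, j) + (if (i + 1, j - 1) \<in> P then 0 else e (i, j - 1)) - d (i, j) - e (i, j))"

lemma balancedD:
  assumes "balanced d e c" "(i, j) \<in> P"
  shows "(i - 1, j + 1) \<in> P \<Longrightarrow> d (i, j + 1) = e (i - 1, j)"
    and "(i + 1, j - 1) \<in> P \<Longrightarrow> d (i + 1, j) = e (i, j - 1)"
    and "c (i, j) = d (i, j + 1) + (if (i - 1, j + 1) \<in> P then 0 else e (i - 1, j))
      + d (i + 1, j) + (if (i + 1, j - 1) \<in> P then 0 else e (i, j - 1)) - d (i, j) - e (i, j)"
  using assms unfolding balanced_def by blast+

lemma balancedI:
  assumes "\<And>i j. \<lbrakk>(i, j) \<in> P; (i - 1, j + 1) \<in> P\<rbrakk> \<Longrightarrow> d (i, j + 1) = e (i - 1, j)"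
    and "\<And>i j. \<lbrakk>(i, j) \<in> P; (i + 1, j - 1) \<in> P\<rbrakk> \<Longrightarrow> d (i + 1, j) = e (i, j - 1)"
    and "\<And>i j. (i, j) \<in> P \<Longrightarrow>
      c (i, j) = d (i, j + 1) + (if (i - 1, j + 1) \<in> P then 0 else e (i - 1, j))
      + d (i + 1, j) + (if (i + 1, j - 1) \<in> P then 0 else e (i, j - 1)) - d (i, j) - e (i, j)"
  shows "balanced d e c"
  using assms unfolding balanced_def by blast

text \<open>The two corners are incomparable with each other and with \<open>p\<close>. So the
  strict down-set of \<open>p\<close> can be enlarged by the down-set of either corner without
  forcing \<open>p\<close> or the other corner.\<close>

lemma ideal_prescribing_corners:
  assumes p: "(i, j) \<in> P"
  obtains I where "I \<in> order_ideals P" "insert (i, j) I \<in> order_ideals P" "(i, j) \<notin> I"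
    "(i - 1, j + 1) \<in> I \<longleftrightarrow> (i - 1, j + 1) \<in> P \<and> A" "(i + 1, j - 1) \<in> I \<longleftrightarrow> (i + 1, j - 1) \<in> P \<and> B"
proof
  let ?I = "{q \<in> P. q < (i, j) \<or> A \<and> q \<le> (i - 1, j + 1) \<or> B \<and> q \<le> (i + 1, j - 1)}"
  show "?I \<in> order_ideals P"
    by (auto simp: order_ideals_def intro: order.trans dest: order.strict_trans1)
  show "insert (i, j) ?I \<in> order_ideals P"
    using p by (auto simp: order_ideals_def intro: order.trans dest: order.strict_trans1 simp: order_less_le)
qed (use p in \<open>auto simp: less_le\<close>)

text \<open>Constancy is tested on additions of single elements, whose increments are known from
  \<open>toggle_comb_insert\<close>. All choices of the two corners are realized by ideals, so the
  local equations are necessary as well as sufficient.\<close>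

lemma toggle_comb_eq_iff_balanced:
  assumes supp: "\<And>q. q \<notin> P \<Longrightarrow> d q = 0" "\<And>q. q \<notin> P \<Longrightarrow> e q = 0"
  shows "(\<exists>a. \<forall>I\<in>order_ideals P. a + toggle_comb d e I = (\<Sum>p\<in>P. c p * ideal_ind P p I))
    \<longleftrightarrow> balanced d e c"
proof -
  let ?F = "\<lambda>I. toggle_comb d e I - (\<Sum>p\<in>P. c p * ideal_ind P p I)"
  have ind: "(\<Sum>q\<in>P. c q * ideal_ind P q (insert p I)) = (\<Sum>q\<in>P. c q * ideal_ind P q I) + c p"
    if "I \<in> order_ideals P" "insert p I \<in> order_ideals P" "p \<in> P" "p \<notin> I" for p I
  proof -
    have "(\<Sum>q\<in>P. c q * ideal_ind P q (insert p I)) =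
      (\<Sum>q\<in>P. c q * ideal_ind P q I + (if q = p then c q else 0))"
      using that by (intro sum.cong) (auto simp: ideal_ind_def indicator_def)
    then show ?thesis using that finite by (simp add: sum.distrib)
  qed
  have "(\<exists>a. \<forall>I\<in>order_ideals P. a + toggle_comb d e I = (\<Sum>p\<in>P. c p * ideal_ind P p I))
    \<longleftrightarrow> (\<exists>a. \<forall>I\<in>order_ideals P. ?F I = a)"
  proof (intro iffI; elim exE)
    fix a assume *: "\<forall>I\<in>order_ideals P. a + toggle_comb d e I = (\<Sum>p\<in>P. c p * ideal_ind P p I)"
    have "?F I = - a" if "I \<in> order_ideals P" for I
      using *[rule_format, OF that] by linarith
    then show "\<exists>a. \<forall>I\<in>order_ideals P. ?F I = a" by blast
  next
    fix a assume *: "\<forall>I\<in>order_ideals P. ?F I = a"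
    have "- a + toggle_comb d e I = (\<Sum>p\<in>P. c p * ideal_ind P p I)" if "I \<in> order_ideals P" for I
      using *[rule_format, OF that] by linarith
    then show "\<exists>a. \<forall>I\<in>order_ideals P. a + toggle_comb d e I = (\<Sum>p\<in>P. c p * ideal_ind P p I)"
      by blast
  qed
  also have "\<dots> \<longleftrightarrow> (\<forall>p I. p \<in> P \<and> p \<notin> I \<and> I \<in> order_ideals P \<and> insert p I \<in> order_ideals P
      \<longrightarrow> ?F (insert p I) = ?F I)" (is "?C \<longleftrightarrow> ?S")
  proof
    assume ?C
    then obtain a where a: "\<And>I. I \<in> order_ideals P \<Longrightarrow> ?F I = a" by blast
    show ?S
      by (intro allI impI, elim conjE) (simp only: a)
  next
    assume S: ?S
    have "?F I = ?F {}" if "I \<in> order_ideals P" for I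
      by (rule toggle_invariant_imp_constant[OF finite _ that, where F = ?F]) (use S in blast)
    then show ?C by blast
  qed
  also have "\<dots> \<longleftrightarrow> (\<forall>i j I. (i, j) \<in> P \<and> (i, j) \<notin> I \<and> I \<in> order_ideals P \<and> insert (i, j) I \<in> order_ideals P
      \<longrightarrow> toggle_comb d e (insert (i, j) I) - toggle_comb d e I = c (i, j))" (is "_ \<longleftrightarrow> ?L")
  proof -
    have "?F (insert (i, j) I) = ?F I \<longleftrightarrow> toggle_comb d e (insert (i, j) I) - toggle_comb d e I = c (i, j)"
      if "(i, j) \<in> P" "(i, j) \<notin> I" "I \<in> order_ideals P" "insert (i, j) I \<in> order_ideals P" for i j I
      using ind[OF that(3,4,1,2)] by linarith
    then show ?thesis by (simp only: split_paired_All) blast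
  qed
  also have "\<dots> \<longleftrightarrow> balanced d e c"
  proof
    assume L: ?L
    show "balanced d e c"
      unfolding balanced_def
    proof (intro allI impI)
      fix i j assume p: "(i, j) \<in> P"
      have "c (i, j) = d (i, j + 1) * of_bool ((i - 1, j + 1) \<in> P \<longrightarrow> A)
        + d (i + 1, j) * of_bool ((i + 1, j - 1) \<in> P \<longrightarrow> B)
        + e (i - 1, j) * of_bool (\<not> ((i - 1, j + 1) \<in> P \<and> A))
        + e (i, j - 1) * of_bool (\<not> ((i + 1, j - 1) \<in> P \<and> B)) - d (i, j) - e (i, j)" for A B
      proof -
        obtain I where I: "I \<in> order_ideals P" "insert (i, j) I \<in> order_ideals P" "(i, j) \<notin> I"
          "(i - 1, j + 1) \<in> I \<longleftrightarrow> (i - 1, j + 1) \<in> P \<and> A" "(i + 1, j - 1) \<in> I \<longleftrightarrow> (i + 1, j - 1) \<in> P \<and> B"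
          using ideal_prescribing_corners[OF p] .
        then have "toggle_comb d e (insert (i, j) I) - toggle_comb d e I = c (i, j)"
          using L p by blast
        then show ?thesis
          using toggle_comb_insert[where d = d and e = e, OF I(1,2) p I(3) supp] I(4,5) by simp
      qed
      \<comment> \<open>Switching one corner isolates the equation for that corner; the first
        instance is the formula for \<open>c (i, j)\<close>.\<close>
      from this[of True True] this[of True False] this[of False True]
      show "((i - 1, j + 1) \<in> P \<longrightarrow> d (i, j + 1) = e (i - 1, j)) \<and>
        ((i + 1, j - 1) \<in> P \<longrightarrow> d (i + 1, j) = e (i, j - 1)) \<and>
        c (i, j) = d (i, j + 1) + (if (i - 1, j + 1) \<in> P then 0 else e (i - 1, j))
          + d (i + 1, j) + (if (i + 1, j - 1) \<in> P then 0 else e (i, j - 1)) - d (i, j) - e (i, j)"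
        by auto
    qed
  next
    assume B: "balanced d e c"
    show ?L
    proof (intro allI impI, elim conjE)
      fix i j I assume p: "(i, j) \<in> P" "(i, j) \<notin> I" and I: "I \<in> order_ideals P" "insert (i, j) I \<in> order_ideals P"
      show "toggle_comb d e (insert (i, j) I) - toggle_comb d e I = c (i, j)"
        using toggle_comb_insert[where d = d and e = e, OF I p supp]
          B p order_ideal_subset[OF I(1)] unfolding balanced_def by auto
    qed
  qed
  finally show ?thesis .
qed

section \<open>Dimensions from parametrized coefficient families\<close>

lemma toggle_comb_same: "toggle_comb d d I = (\<Sum>p\<in>P. d p * toggleability P p I)"
  by (simp add: toggle_comb_def toggleability_def right_diff_distrib sum_subtractf)

lemma toggle_comb_diff:
  "toggle_comb d e I = (\<Sum>p\<in>P. d p * toggleability P p I) - (\<Sum>p\<in>P. (e p - d p) * toggle_out P p I)"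
  by (simp add: toggle_comb_def toggleability_def right_diff_distrib left_diff_distrib sum_subtractf)

lemma vanishing_outside:
  assumes "I \<notin> order_ideals P"
  shows "toggle_out P p I = 0" "toggleability P p I = 0" "ideal_ind P p I = 0"
  using assms by (auto simp: toggleability_def toggle_in_def toggle_out_def ideal_ind_def)

lemma toggle_comb_constant_imp_zero:
  assumes "\<And>I. I \<in> order_ideals P \<Longrightarrow> a + toggle_comb d d I = 0"
    and supp: "\<And>q. q \<notin> P \<Longrightarrow> d q = 0"
  shows "d = (\<lambda>_. 0)"
proof
  fix q
  have "(\<Sum>p\<in>P. d p * toggleability P p I) = - a" if "I \<in> order_ideals P" for I
    using assms(1)[OF that] unfolding toggle_comb_same by simp
  then show "d q = 0"
    using toggleabilities_independent[OF finite, of d "- a" q] supp by blast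
qed

text \<open>By \<open>toggle_comb_diff\<close>, the elements of \<open>A_T\<close> are the
  combinations of the \<open>toggle_out\<close> with coefficients \<open>e - d\<close>, for balanced
  pairs with \<open>c = 0\<close>. The kernel is trivial: independence of the
  \<open>toggle_out\<close> forces \<open>e = d\<close>, and independence of the toggleabilities
  modulo constants then forces \<open>d = 0\<close>.\<close>

lemma dim_A_T_eq_card:
  fixes D E :: "('k \<Rightarrow> real) \<Rightarrow> int \<times> int \<Rightarrow> real"
  assumes K: "finite K"
    and add: "\<And>x y q. D (\<lambda>k. x k + y k) q = D x q + D y q"
      "\<And>x y q. E (\<lambda>k. x k + y k) q = E x q + E y q"
    and scale: "\<And>r x q. D (\<lambda>k. r * x k) q = r * D x q"
      "\<And>r x q. E (\<lambda>k. r * x k) q = r * E x q"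
    and supp: "\<And>x q. q \<notin> P \<Longrightarrow> D x q = 0" "\<And>x q. q \<notin> P \<Longrightarrow> E x q = 0"
    and sound: "\<And>x. (\<forall>k. k \<notin> K \<longrightarrow> x k = 0) \<Longrightarrow> balanced (D x) (E x) (\<lambda>_. 0)"
    and complete: "\<And>d e. \<lbrakk>balanced d e (\<lambda>_. 0); \<forall>q. q \<notin> P \<longrightarrow> d q = 0; \<forall>q. q \<notin> P \<longrightarrow> e q = 0\<rbrakk>
      \<Longrightarrow> \<exists>x. (\<forall>k. k \<notin> K \<longrightarrow> x k = 0) \<and> (\<forall>q\<in>P. d q = D x q \<and> e q = E x q)"
    and inj: "\<And>x. \<lbrakk>\<forall>k. k \<notin> K \<longrightarrow> x k = 0; \<forall>q\<in>P. D x q = 0 \<and> E x q = 0\<rbrakk> \<Longrightarrow> x = (\<lambda>_. 0)"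
  shows "fun_space.dim (A_T P) = card K"
proof (rule dim_eq_card_if_parametrized[OF K, where \<Phi> = "\<lambda>x I. \<Sum>p\<in>P. (E x p - D x p) * toggle_out P p I"])
  let ?\<Phi> = "\<lambda>x I. \<Sum>p\<in>P. (E x p - D x p) * toggle_out P p I"
  let ?X = "{x. \<forall>k. k \<notin> K \<longrightarrow> x k = (0::real)}"
  have const: "\<exists>a. \<forall>I\<in>order_ideals P. a + toggle_comb (D x) (E x) I = 0" if "x \<in> ?X" for x
    using toggle_comb_eq_iff_balanced[where d = "D x" and e = "E x" and c = "\<lambda>_. 0"] supp sound[of x] that
    by simp
  show "?\<Phi> (\<lambda>k. x k + y k) = (\<lambda>I. ?\<Phi> x I + ?\<Phi> y I)" for x y
    by (simp add: add sum.distrib algebra_simps sum_subtractf)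
  show "?\<Phi> (\<lambda>k. r * x k) = (\<lambda>I. r * ?\<Phi> x I)" for r x
    by (simp add: scale sum_distrib_left algebra_simps)
  show "x = (\<lambda>_. 0)" if x: "\<forall>k. k \<notin> K \<longrightarrow> x k = 0" and 0: "?\<Phi> x = (\<lambda>_. 0)" for x
  proof -
    have "E x q - D x q = 0" for q
      using toggle_outs_independent[OF finite, of "\<lambda>p. E x p - D x p" q] fun_cong[OF 0] supp
      by (cases "q \<in> P") auto
    then have eq: "E x = D x" by (simp add: fun_eq_iff)
    then obtain a where "\<forall>I\<in>order_ideals P. a + toggle_comb (D x) (D x) I = 0"
      using const[of x] x by auto
    then have "D x = (\<lambda>_. 0)"
      by (intro toggle_comb_constant_imp_zero supp) auto
    then show ?thesis using inj[OF x] eq by simp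
  qed
  show "A_T P = ?\<Phi> ` ?X"
  proof (intro set_eqI iffI)
    fix f assume "f \<in> A_T P"
    then obtain c a d where f: "f = (\<lambda>I. \<Sum>p\<in>P. c p * toggle_out P p I)"
      "f = (\<lambda>I. a * indicator (order_ideals P) I + (\<Sum>p\<in>P. d p * toggleability P p I))"
      unfolding A_T_def Int_iff span_image_iff[OF finite] toggle_span_iff[OF finite] by blast
    define d' where "d' q = (if q \<in> P then d q else 0)" for q
    \<comment> \<open>Adding \<open>c\<close> to \<open>d\<close> turns the equality of the two
      expansions of \<open>f\<close> into the constancy of a single toggle combination.\<close>
    define e' where "e' q = (if q \<in> P then c q + d q else 0)" for q
    have "toggle_comb d' e' I = (\<Sum>p\<in>P. d p * toggleability P p I) - (\<Sum>p\<in>P. c p * toggle_out P p I)" for I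
      unfolding toggle_comb_diff by (auto simp: d'_def e'_def intro!: arg_cong2[where f = minus] sum.cong)
    then have "a + toggle_comb d' e' I = 0" if "I \<in> order_ideals P" for I
      using fun_cong[OF trans[OF f(1)[symmetric] f(2)], of I] that by simp
    then have "balanced d' e' (\<lambda>_. 0)"
      using toggle_comb_eq_iff_balanced[where d = d' and e = e' and c = "\<lambda>_. 0"]
      by (auto simp: d'_def e'_def)
    then obtain x where x: "x \<in> ?X" "\<forall>q\<in>P. d' q = D x q \<and> e' q = E x q"
      using complete[of d' e'] by (auto simp: d'_def e'_def)
    have "E x p - D x p = c p" if "p \<in> P" for p
      using bspec[OF x(2) that] that by (simp add: d'_def e'_def)
    then have "f = ?\<Phi> x"
      unfolding f(1) by (auto simp: fun_eq_iff intro!: sum.cong)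
    then show "f \<in> ?\<Phi> ` ?X" using x(1) by blast
  next
    fix f assume "f \<in> ?\<Phi> ` ?X"
    then obtain x where x: "x \<in> ?X" "f = ?\<Phi> x" by blast
    obtain a where a: "\<forall>I\<in>order_ideals P. a + toggle_comb (D x) (E x) I = 0"
      using const[OF x(1)] by blast
    have "f I = a * indicator (order_ideals P) I + (\<Sum>p\<in>P. D x p * toggleability P p I)" for I
    proof (cases "I \<in> order_ideals P")
      case True
      then have "a * indicator (order_ideals P) I = a" by simp
      then show ?thesis
        using bspec[OF a True] unfolding toggle_comb_diff x(2) by linarith
    qed (simp add: x(2) vanishing_outside)
    then have "f = (\<lambda>I. a * indicator (order_ideals P) I + (\<Sum>p\<in>P. D x p * toggleability P p I))"
      by blast
    then show "f \<in> A_T P"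
      unfolding A_T_def Int_iff span_image_iff[OF finite] toggle_span_iff[OF finite]
      using x(2) by (intro conjI exI)
  qed
qed

text \<open>This is what remains of \<open>balanced d d c\<close> when \<open>c\<close> is free,
  since the third clause then just defines \<open>c\<close>. The two clauses describe the same unit
  squares, seen from either of the two incomparable side vertices.\<close>

definition square_symmetric :: "(int \<times> int \<Rightarrow> real) \<Rightarrow> bool"
  where "square_symmetric d \<longleftrightarrow> (\<forall>i j. (i, j) \<in> P \<longrightarrow>
    ((i - 1, j + 1) \<in> P \<longrightarrow> d (i, j + 1) = d (i - 1, j)) \<and>
    ((i + 1, j - 1) \<in> P \<longrightarrow> d (i + 1, j) = d (i, j - 1)))"

lemma square_symmetric_iff: "square_symmetric d \<longleftrightarrow> (\<exists>c. balanced d d c)"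
proof
  assume "square_symmetric d"
  then show "\<exists>c. balanced d d c"
    unfolding square_symmetric_def balanced_def
    by (intro exI[of _ "\<lambda>(i, j). d (i, j + 1) + (if (i - 1, j + 1) \<in> P then 0 else d (i - 1, j))
      + d (i + 1, j) + (if (i + 1, j - 1) \<in> P then 0 else d (i, j - 1)) - d (i, j) - d (i, j)"]) simp
qed (unfold square_symmetric_def balanced_def, blast)

lemma square_symmetricD:
  assumes "square_symmetric d" "(i, j) \<in> P" "(i - 1, j + 1) \<in> P"
  shows "d (i, j + 1) = d (i - 1, j)"
  using assms unfolding square_symmetric_def by blast

lemma square_symmetricI:
  assumes "\<And>i j. \<lbrakk>(i, j) \<in> P; (i - 1, j + 1) \<in> P\<rbrakk> \<Longrightarrow> d (i, j + 1) = d (i - 1, j)"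
    and "\<And>i j. \<lbrakk>(i, j) \<in> P; (i + 1, j - 1) \<in> P\<rbrakk> \<Longrightarrow> d (i + 1, j) = d (i, j - 1)"
  shows "square_symmetric d"
  using assms unfolding square_symmetric_def by blast

text \<open>For square-symmetric \<open>d\<close> the coefficients \<open>c\<close> exist by
  \<open>square_symmetric_iff\<close>, and \<open>d\<close> is recovered from the function by
  independence of the toggleabilities modulo constants.\<close>

lemma dim_I_T_eq_card:
  fixes D :: "('k \<Rightarrow> real) \<Rightarrow> int \<times> int \<Rightarrow> real"
  assumes K: "finite K"
    and add: "\<And>x y q. D (\<lambda>k. x k + y k) q = D x q + D y q"
    and scale: "\<And>r x q. D (\<lambda>k. r * x k) q = r * D x q"
    and supp: "\<And>x q. q \<notin> P \<Longrightarrow> D x q = 0"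
    and sound: "\<And>x. (\<forall>k. k \<notin> K \<longrightarrow> x k = 0) \<Longrightarrow> square_symmetric (D x)"
    and complete: "\<And>d. \<lbrakk>square_symmetric d; \<forall>q. q \<notin> P \<longrightarrow> d q = 0\<rbrakk>
      \<Longrightarrow> \<exists>x. (\<forall>k. k \<notin> K \<longrightarrow> x k = 0) \<and> (\<forall>q\<in>P. d q = D x q)"
    and inj: "\<And>x. \<lbrakk>\<forall>k. k \<notin> K \<longrightarrow> x k = 0; \<forall>q\<in>P. D x q = 0\<rbrakk> \<Longrightarrow> x = (\<lambda>_. 0)"
  shows "fun_space.dim (I_T P) = card K"
proof -
  text \<open>Functions in the span of the \<open>ideal_ind\<close> vanish at the empty ideal; this fixes the constant.\<close>
  define \<Phi> where "\<Phi> x I = toggle_comb (D x) (D x) I - toggle_comb (D x) (D x) {} * indicator (order_ideals P) I"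
    for x I
  let ?X = "{x. \<forall>k. k \<notin> K \<longrightarrow> x k = (0::real)}"
  have empty: "(\<Sum>p\<in>P. c p * ideal_ind P p {}) = 0" for c
    by (simp add: ideal_ind_def)
  show ?thesis
  proof (rule dim_eq_card_if_parametrized[OF K, where \<Phi> = \<Phi>])
    show "\<Phi> (\<lambda>k. x k + y k) = (\<lambda>I. \<Phi> x I + \<Phi> y I)" for x y
      by (simp add: fun_eq_iff \<Phi>_def toggle_comb_same add sum.distrib algebra_simps)
    show "\<Phi> (\<lambda>k. r * x k) = (\<lambda>I. r * \<Phi> x I)" for r x
      by (simp add: fun_eq_iff \<Phi>_def toggle_comb_same scale sum_distrib_left algebra_simps)
    show "x = (\<lambda>_. 0)" if x: "\<forall>k. k \<notin> K \<longrightarrow> x k = 0" and 0: "\<Phi> x = (\<lambda>_. 0)" for x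
    proof -
      have "- toggle_comb (D x) (D x) {} + toggle_comb (D x) (D x) I = 0" if "I \<in> order_ideals P" for I
        using fun_cong[OF 0, of I] that by (simp add: \<Phi>_def)
      then have "D x = (\<lambda>_. 0)"
        by (rule toggle_comb_constant_imp_zero[OF _ supp])
      then show ?thesis using inj[OF x] by simp
    qed
    show "I_T P = \<Phi> ` ?X"
    proof (intro set_eqI iffI)
      fix f assume "f \<in> I_T P"
      then obtain c a d where f: "f = (\<lambda>I. \<Sum>p\<in>P. c p * ideal_ind P p I)"
        "f = (\<lambda>I. a * indicator (order_ideals P) I + (\<Sum>p\<in>P. d p * toggleability P p I))"
        unfolding I_T_def Int_iff span_image_iff[OF finite] toggle_span_iff[OF finite] by blast
      define d' where "d' q = (if q \<in> P then d q else 0)" for q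
      have d': "toggle_comb d' d' I = (\<Sum>p\<in>P. d p * toggleability P p I)" for I
        unfolding toggle_comb_same by (auto simp: d'_def intro!: sum.cong)
      have eq: "a + toggle_comb d' d' I = (\<Sum>p\<in>P. c p * ideal_ind P p I)" if "I \<in> order_ideals P" for I
        using fun_cong[OF trans[OF f(1)[symmetric] f(2)], of I] that d' by simp
      then have "balanced d' d' c"
        using toggle_comb_eq_iff_balanced[where d = d' and e = d' and c = c] by (auto simp: d'_def)
      then obtain x where x: "x \<in> ?X" "\<forall>q\<in>P. d' q = D x q"
        using complete[of d'] square_symmetric_iff by (auto simp: d'_def)
      then have "D x = d'" using supp by (auto simp: fun_eq_iff d'_def)
      moreover have "a = - toggle_comb d' d' {}"
        using eq[OF empty_order_ideal] by (simp add: empty)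
      ultimately have "f = \<Phi> x"
        unfolding f(2) by (simp add: \<Phi>_def[abs_def] d')
      then show "f \<in> \<Phi> ` ?X" using x(1) by blast
    next
      fix f assume "f \<in> \<Phi> ` ?X"
      then obtain x where x: "x \<in> ?X" "f = \<Phi> x" by blast
      obtain c where "balanced (D x) (D x) c"
        using sound[of x] x(1) square_symmetric_iff by auto
      then obtain a where a: "\<forall>I\<in>order_ideals P. a + toggle_comb (D x) (D x) I = (\<Sum>p\<in>P. c p * ideal_ind P p I)"
        using toggle_comb_eq_iff_balanced[where d = "D x" and e = "D x" and c = c] supp by auto
      have a0: "a = - toggle_comb (D x) (D x) {}"
        using bspec[OF a empty_order_ideal] by (simp add: empty)
      have "f I = (\<Sum>p\<in>P. c p * ideal_ind P p I)" for I
      proof (cases "I \<in> order_ideals P")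
        case True
        then show ?thesis using bspec[OF a True] a0 by (simp add: x(2) \<Phi>_def)
      qed (simp add: x(2) \<Phi>_def toggle_comb_same vanishing_outside)
      then have "f = (\<lambda>I. \<Sum>p\<in>P. c p * ideal_ind P p I)" by blast
      moreover have "f = (\<lambda>I. (- toggle_comb (D x) (D x) {}) * indicator (order_ideals P) I
          + (\<Sum>p\<in>P. D x p * toggleability P p I))"
        by (auto simp: x(2) \<Phi>_def toggle_comb_same fun_eq_iff)
      ultimately show "f \<in> I_T P"
        unfolding I_T_def Int_iff span_image_iff[OF finite] toggle_span_iff[OF finite]
        by (intro conjI exI)
    qed
  qed
qed

end

section \<open>Maximal chains and recurrences in the integer grid\<close>

lemma poset_rank_eqI:
  fixes P :: "(int \<times> int) set"
  assumes fin: "finite P" and "l \<le> h"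
    and range: "\<And>i j. (i, j) \<in> P \<Longrightarrow> l \<le> i + j \<and> i + j \<le> h"
    and path: "\<And>s. \<lbrakk>l \<le> s; s \<le> h\<rbrakk> \<Longrightarrow> g s \<in> P \<and> fst (g s) + snd (g s) = s"
    and mono: "\<And>s t. s \<le> t \<Longrightarrow> g s \<le> g t"
  shows "poset_rank P + 1 = h - l + 1"
proof -
  let ?r = "\<lambda>p :: int \<times> int. fst p + snd p"
  let ?S = "{card C |C. C \<subseteq> P \<and> Complete_Partial_Order.chain (\<le>) C}"
  have le: "card C \<le> nat (h - l + 1)" if C: "C \<subseteq> P" "Complete_Partial_Order.chain (\<le>) C" for C
  proof -
    \<comment> \<open>The height \<open>i + j\<close> is strictly monotone, so a chain has at most
      one element of each height.\<close>
    have "inj_on ?r C"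
    proof (rule inj_onI)
      fix p q assume "p \<in> C" "q \<in> C" and eq: "?r p = ?r q"
      then have "p \<le> q \<or> q \<le> p" using C(2) by (auto simp: chain_def)
      then show "p = q" using eq by (auto simp: less_eq_prod_def prod_eq_iff)
    qed
    then have "card C = card (?r ` C)" by (simp add: card_image)
    also have "\<dots> \<le> card {l..h}"
      using C(1) range by (intro card_mono) force+
    finally show ?thesis by simp
  qed
  \<comment> \<open>Conversely, the monotone path \<open>g\<close> is a chain that meets every
    height.\<close>
  have "inj_on g {l..h}"
    by (rule inj_on_inverseI[of _ ?r]) (use path in auto)
  then have "card (g ` {l..h}) = nat (h - l + 1)" by (simp add: card_image)
  moreover have "g ` {l..h} \<subseteq> P" using path by auto
  moreover have "Complete_Partial_Order.chain (\<le>) (g ` {l..h})"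
    by (auto simp: chain_def) (meson mono linear)
  ultimately have "nat (h - l + 1) \<in> ?S" by (metis (mono_tags, lifting) mem_Collect_eq)
  moreover have "finite ?S"
    by (rule finite_subset[of _ "{..nat (h - l + 1)}"]) (use le in auto)
  ultimately have "Max ?S = nat (h - l + 1)"
    using le by (intro Max_eqI) auto
  then show ?thesis using \<open>l \<le> h\<close> by (simp add: poset_rank_def)
qed

lemma interval_constant:
  fixes f :: "int \<Rightarrow> 'a"
  assumes step: "\<And>k. \<lbrakk>a \<le> k; k < b\<rbrakk> \<Longrightarrow> f (k + 1) = f k" and k: "a \<le> k" "k \<le> b"
  shows "f k = f a"
  using k
proof (induction k rule: int_ge_induct)
  case (step k)
  then show ?case using assms(1)[of k] by simp
qed simp

lemma diagonal_constant:
  fixes d :: "int \<times> int \<Rightarrow> 'a"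
  assumes "\<And>s. \<lbrakk>0 \<le> s; s < t\<rbrakk> \<Longrightarrow> d (i - s, j - s) = d (i - s - 1, j - s - 1)" and "0 \<le> t"
  shows "d (i, j) = d (i - t, j - t)"
  using interval_constant[of 0 t "\<lambda>s. d (i - s, j - s)" t] assms
  by (simp add: diff_diff_eq[symmetric])

text \<open>Vanishing mixed second differences split \<open>u\<close> into a function of
  \<open>i\<close> plus a function of \<open>j\<close>. The splitting is normalized at the corner
  \<open>(1, n + 1)\<close>, where \<open>u\<close> vanishes in the application to
  rectangles.\<close>

lemma grid_additive:
  fixes u :: "int \<times> int \<Rightarrow> real"
  assumes eq: "\<And>i j. \<lbrakk>1 \<le> i; i \<le> m; 1 \<le> j; j \<le> n\<rbrakk>
      \<Longrightarrow> u (i + 1, j + 1) + u (i, j) = u (i, j + 1) + u (i + 1, j)"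
    and ij: "1 \<le> i" "i \<le> m + 1" "1 \<le> j" "j \<le> n + 1"
  shows "u (i, j) + u (1, n + 1) = u (i, n + 1) + u (1, j)"
proof -
  have row: "u (k + 1, l) - u (k, l) = u (k + 1, 1) - u (k, 1)"
    if "1 \<le> k" "k \<le> m" "1 \<le> l" "l \<le> n + 1" for k l
  proof (rule interval_constant[where f = "\<lambda>l. u (k + 1, l) - u (k, l)" and b = "n + 1"])
    fix l assume "1 \<le> l" "l < n + 1"
    then show "u (k + 1, l + 1) - u (k, l + 1) = u (k + 1, l) - u (k, l)"
      using eq[of k l] that by simp
  qed (use that in auto)
  have "u (i, j) - u (i, n + 1) = u (1, j) - u (1, n + 1)"
  proof (rule interval_constant[where f = "\<lambda>i. u (i, j) - u (i, n + 1)" and b = "m + 1"])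
    fix k assume k: "1 \<le> k" "k < m + 1"
    show "u (k + 1, j) - u (k + 1, n + 1) = u (k, j) - u (k, n + 1)"
      using row[of k j] row[of k "n + 1"] k ij by simp
  qed (use ij in auto)
  then show ?thesis by simp
qed

section \<open>The four families and their ranks\<close>

lemma grid_poset_rectangle: "grid_poset (rectangle m n)"
proof
  show "finite (rectangle m n)"
    by (rule finite_subset[of _ "{1..int m} \<times> {1..int n}"]) (auto simp: rectangle_def)
qed (auto simp: rectangle_def order_less_le)

lemma grid_poset_shifted_staircase: "grid_poset (shifted_staircase n)"
proof
  show "finite (shifted_staircase n)"
    by (rule finite_subset[of _ "{1..int n} \<times> {1..int n}"]) (auto simp: shifted_staircase_def)
qed (auto simp: shifted_staircase_def order_less_le)

lemma grid_poset_root_poset_A: "grid_poset (root_poset_A n)"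
proof
  show "finite (root_poset_A n)"
    by (rule finite_subset[of _ "{1..int n} \<times> {1..int n}"]) (auto simp: root_poset_A_def)
qed (auto simp: root_poset_A_def order_less_le)

lemma grid_poset_root_poset_B: "grid_poset (root_poset_B n)"
proof
  show "finite (root_poset_B n)"
    by (rule finite_subset[of _ "{1..2 * int n} \<times> {1..2 * int n}"]) (auto simp: root_poset_B_def)
qed (auto simp: root_poset_B_def order_less_le)

lemma poset_rank_rectangle:
  assumes "m \<ge> 1" "n \<ge> 1"
  shows "poset_rank (rectangle m n) + 1 = int m + int n - 1"
proof -
  \<comment> \<open>The chain follows the edge \<open>j = 1\<close> up to \<open>(m, 1)\<close> and
    then the edge \<open>i = m\<close>.\<close>
  have "poset_rank (rectangle m n) + 1 = (int m + int n) - 2 + 1"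
    by (rule poset_rank_eqI[OF grid_poset.finite[OF grid_poset_rectangle], where g = "\<lambda>s. (min (s - 1) (int m), max 1 (s - int m))"])
      (use assms in \<open>auto simp: rectangle_def\<close>)
  then show ?thesis by simp
qed

lemma poset_rank_shifted_staircase:
  assumes "n \<ge> 1"
  shows "poset_rank (shifted_staircase n) + 1 = 2 * int n - 1"
proof -
  \<comment> \<open>The chain follows the edge \<open>i = 1\<close> up to \<open>(1, n)\<close> and
    then the edge \<open>j = n\<close>.\<close>
  have "poset_rank (shifted_staircase n) + 1 = 2 * int n - 2 + 1"
    by (rule poset_rank_eqI[OF grid_poset.finite[OF grid_poset_shifted_staircase], where g = "\<lambda>s. (max 1 (s - int n), min (s - 1) (int n))"])
      (use assms in \<open>auto simp: shifted_staircase_def\<close>)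
  then show ?thesis by simp
qed

lemma poset_rank_root_poset_A:
  assumes "n \<ge> 1"
  shows "poset_rank (root_poset_A n) + 1 = int n"
proof -
  have "poset_rank (root_poset_A n) + 1 = 2 * int n - (int n + 1) + 1"
    by (rule poset_rank_eqI[OF grid_poset.finite[OF grid_poset_root_poset_A], where g = "\<lambda>s. (s - int n, int n)"])
      (use assms in \<open>auto simp: root_poset_A_def\<close>)
  then show ?thesis by simp
qed

lemma poset_rank_root_poset_B:
  assumes "n \<ge> 1"
  shows "poset_rank (root_poset_B n) + 1 = 2 * int n - 1"
proof -
  have "poset_rank (root_poset_B n) + 1 = 4 * int n - 2 - (2 * int n) + 1"
    by (rule poset_rank_eqI[OF grid_poset.finite[OF grid_poset_root_poset_B], where g = "\<lambda>s. (2 * int n - 1, s - (2 * int n - 1))"])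
      (use assms in \<open>auto simp: root_poset_B_def\<close>)
  then show ?thesis by simp
qed

section \<open>Dimensions of the toggleability spaces\<close>

lemma dim_I_T_rectangle:
  assumes "m \<ge> 1" "n \<ge> 1"
  shows "int (fun_space.dim (I_T (rectangle m n))) = int m + int n - 1"
proof -
  let ?P = "rectangle m n"
  \<comment> \<open>One parameter for each diagonal: \<open>i - j\<close> runs from
    \<open>1 - n\<close> to \<open>m - 1\<close>, and the shift by \<open>n\<close> makes the index
    start at \<open>1\<close>. Squares with both sides in \<open>P\<close> also have bottom and top
    in \<open>P\<close>, so the condition is constancy along diagonals.\<close>
  let ?D = "\<lambda>x (i, j). if (i, j) \<in> ?P then x (i - j + int n) else (0::real)"
  interpret grid_poset ?P by (rule grid_poset_rectangle)
  have "fun_space.dim (I_T ?P) = card {1..int m + int n - 1}"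
  proof (rule dim_I_T_eq_card[where D = ?D])
    fix d assume d: "square_symmetric d"
    define x where "x k = (if k \<in> {1..int m + int n - 1}
      then d (max 1 (k - int n + 1), max 1 (int n - k + 1)) else 0)" for k
    have "d (i, j) = x (i - j + int n)" if p: "(i, j) \<in> ?P" for i j
    proof -
      \<comment> \<open>After \<open>min i j - 1\<close> steps down, the first element of the
        diagonal is reached, on the edge \<open>i = 1\<close> or \<open>j = 1\<close>; there
        \<open>x\<close> is read off.\<close>
      have "d (i, j) = d (i - (min i j - 1), j - (min i j - 1))"
      proof (rule diagonal_constant)
        fix s assume "0 \<le> s" "s < min i j - 1"
        then show "d (i - s, j - s) = d (i - s - 1, j - s - 1)"
          using square_symmetricD[OF d, of "i - s" "j - s - 1"] p by (auto simp: rectangle_def)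
      qed (use p in \<open>auto simp: rectangle_def\<close>)
      moreover have "i - (min i j - 1) = max 1 (i - j + int n - int n + 1)"
        "j - (min i j - 1) = max 1 (int n - (i - j + int n) + 1)"
        by auto
      ultimately show ?thesis using p by (auto simp: x_def rectangle_def)
    qed
    then show "\<exists>x. (\<forall>k. k \<notin> {1..int m + int n - 1} \<longrightarrow> x k = 0)
        \<and> (\<forall>q\<in>?P. d q = ?D x q)"
      by (intro exI[of _ x]) (auto simp: x_def)
  next
    fix x :: "int \<Rightarrow> real"
    assume supp: "\<forall>k. k \<notin> {1..int m + int n - 1} \<longrightarrow> x k = 0"
      and 0: "\<forall>q\<in>?P. ?D x q = 0"
    have "x k = 0" if "k \<in> {1..int m + int n - 1}" for k
      using bspec[OF 0, of "(1, int n - k + 1)"] bspec[OF 0, of "(k - int n + 1, 1)"] that assms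
      by (cases "k \<le> int n") (auto simp: rectangle_def)
    then show "x = (\<lambda>_. 0)" using supp by blast
  next
    fix x :: "int \<Rightarrow> real"
    show "square_symmetric (?D x)"
      by (rule square_symmetricI) (auto simp: rectangle_def algebra_simps)
  qed (auto simp: algebra_simps split: if_splits)
  then show ?thesis using assms by simp
qed

text \<open>No unit square with both sides in \<open>P\<close> has its bottom or top on
  \<open>i = j\<close>, so the \<open>n\<close> values there are free and get the indices up to
  \<open>n\<close>. The remaining \<open>n - 1\<close> diagonals start on the edge
  \<open>i = 1\<close> and get the larger indices.\<close>

lemma dim_I_T_shifted_staircase:
  assumes "n \<ge> 1"
  shows "int (fun_space.dim (I_T (shifted_staircase n))) = 2 * int n - 1"
proof -
  let ?P = "shifted_staircase n"
  let ?D = "\<lambda>x (i, j). if (i, j) \<in> ?P then if i < j then x (int n + j - i) else x i else (0::real)"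
  interpret grid_poset ?P by (rule grid_poset_shifted_staircase)
  have "fun_space.dim (I_T ?P) = card {1..2 * int n - 1}"
  proof (rule dim_I_T_eq_card[where D = ?D])
    fix d assume d: "square_symmetric d"
    define x where "x k = (if k \<in> {1..2 * int n - 1}
      then if k \<le> int n then d (k, k) else d (1, 1 + k - int n) else 0)" for k
    have "d (i, j) = x (int n + j - i)" if p: "(i, j) \<in> ?P" "i < j" for i j
    proof -
      have "d (i, j) = d (i - (i - 1), j - (i - 1))"
      proof (rule diagonal_constant)
        fix s assume "0 \<le> s" "s < i - 1"
        then show "d (i - s, j - s) = d (i - s - 1, j - s - 1)"
          using square_symmetricD[OF d, of "i - s" "j - s - 1"] p by (auto simp: shifted_staircase_def)
      qed (use p in \<open>auto simp: shifted_staircase_def\<close>)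
      then show ?thesis using p by (auto simp: x_def shifted_staircase_def algebra_simps)
    qed
    moreover have "d (i, i) = x i" if "(i, i) \<in> ?P" for i
      using that by (auto simp: x_def shifted_staircase_def)
    ultimately have "d q = ?D x q" if "q \<in> ?P" for q
      using that by (cases q) (auto simp: shifted_staircase_def)
    then show "\<exists>x. (\<forall>k. k \<notin> {1..2 * int n - 1} \<longrightarrow> x k = 0) \<and> (\<forall>q\<in>?P. d q = ?D x q)"
      by (intro exI[of _ x]) (auto simp: x_def)
  next
    fix x :: "int \<Rightarrow> real"
    assume supp: "\<forall>k. k \<notin> {1..2 * int n - 1} \<longrightarrow> x k = 0" and 0: "\<forall>q\<in>?P. ?D x q = 0"
    have "x k = 0" if "k \<in> {1..2 * int n - 1}" for k
      using bspec[OF 0, of "(k, k)"] bspec[OF 0, of "(1, 1 + k - int n)"] that assms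
      by (cases "k \<le> int n") (auto simp: shifted_staircase_def)
    then show "x = (\<lambda>_. 0)" using supp by blast
  next
    fix x :: "int \<Rightarrow> real"
    show "square_symmetric (?D x)"
      by (rule square_symmetricI) (auto simp: shifted_staircase_def algebra_simps)
  qed (auto simp: algebra_simps split: if_splits)
  then show ?thesis using assms by simp
qed

text \<open>Along a diagonal \<open>i + j\<close> changes by two. The diagonal through the rank-zero
  element \<open>(k, n + 1 - k)\<close> satisfies \<open>i - j + n + 1 = 2 * k\<close> and carries
  one free value; on the diagonals of the other parity \<open>d\<close> is forced to vanish.\<close>

lemma dim_I_T_root_poset_A:
  "int (fun_space.dim (I_T (root_poset_A n))) = int n"
proof -
  let ?P = "root_poset_A n"
  let ?D = "\<lambda>x (i, j). if (i, j) \<in> ?P then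
    if even (i - j + int n + 1) then x ((i - j + int n + 1) div 2) else 0 else (0::real)"
  interpret grid_poset ?P by (rule grid_poset_root_poset_A)
  have "fun_space.dim (I_T ?P) = card {1..int n}"
  proof (rule dim_I_T_eq_card[where D = ?D])
    fix d assume d: "square_symmetric d" and supp: "\<forall>q. q \<notin> ?P \<longrightarrow> d q = 0"
    define x where "x k = (if k \<in> {1..int n} then d (k, int n + 1 - k) else 0)" for k
    have diag: "d (i, j) = d (i - t, j - t)" if "(i, j) \<in> ?P" "0 \<le> t" "2 * t \<le> i + j - int n - 1" for i j t
    proof (rule diagonal_constant)
      fix s assume "0 \<le> s" "s < t"
      then show "d (i - s, j - s) = d (i - s - 1, j - s - 1)"
        using square_symmetricD[OF d, of "i - s" "j - s - 1"] that by (auto simp: root_poset_A_def)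
    qed (use that in auto)
    have even: "d (i, j) = x k" if p: "(i, j) \<in> ?P" and k: "i - j + int n + 1 = 2 * k" for i j k
    proof -
      have "d (i, j) = d (i - (i - k), j - (i - k))"
        by (rule diag) (use p k in \<open>auto simp: root_poset_A_def\<close>)
      moreover have "j - (i - k) = int n + 1 - k" using k by simp
      ultimately show ?thesis using p k by (auto simp: x_def root_poset_A_def)
    qed
    have odd: "d (i, j) = 0" if p: "(i, j) \<in> ?P" and k: "i - j + int n + 1 = 2 * k + 1" for i j k
    proof -
      text \<open>The diagonal starts at an element of rank one, above a square without bottom.\<close>
      have "d (i, j) = d (i - (i - k - 1), j - (i - k - 1))"
        by (rule diag) (use p k in \<open>auto simp: root_poset_A_def\<close>)
      also have "i - (i - k - 1) = k + 1" by simp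
      also have "j - (i - k - 1) = int n - k + 1" using k by simp
      also have "d (k + 1, int n - k + 1) = d (k + 1 - 1, int n - k)"
        by (rule square_symmetricD[OF d]) (use p k in \<open>auto simp: root_poset_A_def\<close>)
      also have "\<dots> = 0" using supp by (simp add: root_poset_A_def)
      finally show ?thesis .
    qed
    have "d q = ?D x q" if "q \<in> ?P" for q
    proof (cases q)
      case (Pair i j)
      show ?thesis
      proof (cases "even (i - j + int n + 1)")
        case True
        then obtain k where k: "i - j + int n + 1 = 2 * k" by (rule evenE)
        then have "(i - j + int n + 1) div 2 = k" by simp
        then show ?thesis using even[OF _ k] True that Pair by simp
      next
        case False
        then obtain k where "i - j + int n + 1 = 2 * k + 1" by (rule oddE)
        then show ?thesis using odd[of i j k] False that Pair by simp
      qed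
    qed
    then show "\<exists>x. (\<forall>k. k \<notin> {1..int n} \<longrightarrow> x k = 0) \<and> (\<forall>q\<in>?P. d q = ?D x q)"
      by (intro exI[of _ x]) (auto simp: x_def)
  next
    fix x :: "int \<Rightarrow> real"
    assume supp: "\<forall>k. k \<notin> {1..int n} \<longrightarrow> x k = 0" and 0: "\<forall>q\<in>?P. ?D x q = 0"
    have "x k = 0" if "k \<in> {1..int n}" for k
      using bspec[OF 0, of "(k, int n + 1 - k)"] that by (auto simp: root_poset_A_def)
    then show "x = (\<lambda>_. 0)" using supp by blast
  next
    fix x :: "int \<Rightarrow> real"
    \<comment> \<open>At a square without bottom the condition demands the value zero at the top,
      which has rank one and so lies on a diagonal of odd index.\<close>
    have rank1: "?D x (i, j) = 0" if "i + j = int n + 1 + 1" for i j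
    proof -
      have "i - j + int n + 1 = 2 * (int n + 1 - j) + 1" using that by simp
      then have "odd (i - j + int n + 1)" by presburger
      then show ?thesis by simp
    qed
    show "square_symmetric (?D x)"
    proof (rule square_symmetricI)
      fix i j assume p: "(i, j) \<in> ?P" "(i - 1, j + 1) \<in> ?P"
      show "?D x (i, j + 1) = ?D x (i - 1, j)"
      proof (cases "i + j = int n + 1")
        case True
        then show ?thesis using rank1[of i "j + 1"] p by (simp add: root_poset_A_def)
      next
        case False
        then have "(i, j + 1) \<in> ?P" "(i - 1, j) \<in> ?P" using p by (auto simp: root_poset_A_def)
        moreover have "i - (j + 1) = i - 1 - j" by simp
        ultimately show ?thesis by (simp only: prod.case if_True if_False)
      qed
    next
      fix i j assume p: "(i, j) \<in> ?P" "(i + 1, j - 1) \<in> ?P"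
      show "?D x (i + 1, j) = ?D x (i, j - 1)"
      proof (cases "i + j = int n + 1")
        case True
        then show ?thesis using rank1[of "i + 1" j] p by (simp add: root_poset_A_def)
      next
        case False
        then have "(i + 1, j) \<in> ?P" "(i, j - 1) \<in> ?P" using p by (auto simp: root_poset_A_def)
        moreover have "i + 1 - j = i - (j - 1)" by simp
        ultimately show ?thesis by (simp only: prod.case if_True if_False)
      qed
    qed
  qed (auto simp: algebra_simps split: if_splits)
  then show ?thesis by simp
qed

text \<open>The \<open>n\<close> values on \<open>i = j\<close> are free, with indices
  \<open>n\<close> to \<open>2 * n - 1\<close>. A diagonal with \<open>i - j = 2 * k > 0\<close>
  starts at \<open>(n + k, n - k)\<close> and supplies the index \<open>k < n\<close>. Diagonals
  with \<open>i - j\<close> odd start in rank one above a square without bottom, hence carry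
  zero.\<close>

lemma dim_I_T_root_poset_B:
  assumes "n \<ge> 1"
  shows "int (fun_space.dim (I_T (root_poset_B n))) = 2 * int n - 1"
proof -
  let ?P = "root_poset_B n"
  let ?D = "\<lambda>x (i, j). if (i, j) \<in> ?P then if i = j then x i
    else if even (i - j) then x ((i - j) div 2) else 0 else (0::real)"
  interpret grid_poset ?P by (rule grid_poset_root_poset_B)
  have "fun_space.dim (I_T ?P) = card {1..2 * int n - 1}"
  proof (rule dim_I_T_eq_card[where D = ?D])
    fix d assume d: "square_symmetric d" and supp: "\<forall>q. q \<notin> ?P \<longrightarrow> d q = 0"
    define x where "x k = (if k \<in> {1..2 * int n - 1}
      then if k \<ge> int n then d (k, k) else d (int n + k, int n - k) else 0)" for k
    have diag: "d (i, j) = d (i - t, j - t)"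
      if "(i, j) \<in> ?P" "j < i" "0 \<le> t" "2 * t \<le> i + j - 2 * int n" for i j t
    proof (rule diagonal_constant)
      fix s assume "0 \<le> s" "s < t"
      then show "d (i - s, j - s) = d (i - s - 1, j - s - 1)"
        using square_symmetricD[OF d, of "i - s" "j - s - 1"] that by (auto simp: root_poset_B_def)
    qed (use that in auto)
    have even: "d (i, j) = x k" if p: "(i, j) \<in> ?P" "j < i" and k: "i - j = 2 * k" for i j k
    proof -
      have "d (i, j) = d (i - (i - k - int n), j - (i - k - int n))"
        by (rule diag) (use p k in \<open>auto simp: root_poset_B_def\<close>)
      also have "i - (i - k - int n) = int n + k" by simp
      also have "j - (i - k - int n) = int n - k" using k by simp
      finally show ?thesis using p k by (auto simp: x_def root_poset_B_def)
    qed
    have odd: "d (i, j) = 0" if p: "(i, j) \<in> ?P" "j < i" and k: "i - j = 2 * k + 1" for i j k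
    proof -
      have "d (i, j) = d (i - (i - k - int n - 1), j - (i - k - int n - 1))"
        by (rule diag) (use p k in \<open>auto simp: root_poset_B_def\<close>)
      also have "i - (i - k - int n - 1) = int n + k + 1" by simp
      also have "j - (i - k - int n - 1) = int n - k - 1 + 1" using k by simp
      also have "d (int n + k + 1, int n - k - 1 + 1) = d (int n + k + 1 - 1, int n - k - 1)"
        by (rule square_symmetricD[OF d]) (use p k in \<open>auto simp: root_poset_B_def\<close>)
      also have "\<dots> = 0" using supp by (simp add: root_poset_B_def)
      finally show ?thesis .
    qed
    have "d q = ?D x q" if "q \<in> ?P" for q
    proof (cases q)
      case (Pair i j)
      with that have "j \<le> i" by (simp add: root_poset_B_def)
      then consider "i = j" | "j < i" "even (i - j)" | "j < i" "odd (i - j)" by linarith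
      then show ?thesis
      proof cases
        case 1
        then show ?thesis using that Pair by (auto simp: x_def root_poset_B_def)
      next
        case 2
        obtain k where k: "i - j = 2 * k" using 2(2) by (rule evenE)
        then have "(i - j) div 2 = k" by simp
        then show ?thesis using even[OF _ _ k] 2 that Pair by simp
      next
        case 3
        obtain k where "i - j = 2 * k + 1" using 3(2) by (rule oddE)
        then show ?thesis using odd[of i j k] 3 that Pair by simp
      qed
    qed
    then show "\<exists>x. (\<forall>k. k \<notin> {1..2 * int n - 1} \<longrightarrow> x k = 0) \<and> (\<forall>q\<in>?P. d q = ?D x q)"
      by (intro exI[of _ x]) (auto simp: x_def)
  next
    fix x :: "int \<Rightarrow> real"
    assume supp: "\<forall>k. k \<notin> {1..2 * int n - 1} \<longrightarrow> x k = 0" and 0: "\<forall>q\<in>?P. ?D x q = 0"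
    have "x k = 0" if "k \<in> {1..2 * int n - 1}" for k
      using bspec[OF 0, of "(k, k)"] bspec[OF 0, of "(int n + k, int n - k)"] that
      by (cases "k \<ge> int n") (auto simp: root_poset_B_def)
    then show "x = (\<lambda>_. 0)" using supp by blast
  next
    fix x :: "int \<Rightarrow> real"
    have rank1: "?D x (i, j) = 0" if "i + j = 2 * int n + 1" "j < i" for i j
    proof -
      have "i - j = 2 * (int n - j) + 1" using that by simp
      then have "odd (i - j)" by presburger
      then show ?thesis using that by simp
    qed
    show "square_symmetric (?D x)"
    proof (rule square_symmetricI)
      fix i j assume p: "(i, j) \<in> ?P" "(i - 1, j + 1) \<in> ?P"
      show "?D x (i, j + 1) = ?D x (i - 1, j)"
      proof (cases "i + j = 2 * int n")
        case True
        then show ?thesis using rank1[of i "j + 1"] p by (simp add: root_poset_B_def)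
      next
        case False
        then have "(i, j + 1) \<in> ?P" "(i - 1, j) \<in> ?P" using p by (auto simp: root_poset_B_def)
        moreover have "(i = j + 1) = False" "(i - 1 = j) = False" using p by (auto simp: root_poset_B_def)
        moreover have "i - (j + 1) = i - 1 - j" by simp
        ultimately show ?thesis by (simp only: prod.case if_True if_False)
      qed
    next
      fix i j assume p: "(i, j) \<in> ?P" "(i + 1, j - 1) \<in> ?P"
      show "?D x (i + 1, j) = ?D x (i, j - 1)"
      proof (cases "i + j = 2 * int n")
        case True
        then show ?thesis using rank1[of "i + 1" j] p by (simp add: root_poset_B_def)
      next
        case False
        then have "(i + 1, j) \<in> ?P" "(i, j - 1) \<in> ?P" using p by (auto simp: root_poset_B_def)
        moreover have "(i + 1 = j) = False" "(i = j - 1) = False" using p by (auto simp: root_poset_B_def)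
        moreover have "i + 1 - j = i - (j - 1)" by simp
        ultimately show ?thesis by (simp only: prod.case if_True if_False)
      qed
    qed
  qed (auto simp: algebra_simps split: if_splits)
  then show ?thesis using assms by simp
qed

section \<open>Balanced pairs on the four families\<close>

lemma dim_A_T_rectangle:
  assumes "m \<ge> 2" "n \<ge> 2"
  shows "int (fun_space.dim (A_T (rectangle m n))) = int m + int n - 1"
proof -
  let ?P = "rectangle m n"
  define M N where "M = int m" and "N = int n"
  have MN: "M \<ge> 2" "N \<ge> 2" using assms by (auto simp: M_def N_def)
  have P: "(i, j) \<in> ?P \<longleftrightarrow> 1 \<le> i \<and> i \<le> M \<and> 1 \<le> j \<and> j \<le> N" for i j
    by (simp add: rectangle_def M_def N_def)
  let ?K = "{1..M + N - 1}"
  \<comment> \<open>Here \<open>u (i, j) = x (i - 1) - x (M + j - 1)\<close>: the first coordinate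
    uses \<open>x 0\<close> to \<open>x M\<close>, the second \<open>x M\<close> to
    \<open>x (M + N)\<close>. Sharing \<open>x M\<close> encodes \<open>u (M + 1, 1) = 0\<close>,
    and the vanishing of \<open>x 0\<close> and \<open>x (M + N)\<close> encodes
    \<open>u (1, N + 1) = 0\<close>.\<close>
  let ?D = "\<lambda>x (i, j). if (i, j) \<in> ?P then x (i - 1) - x (M + j - 1) else (0::real)"
  let ?E = "\<lambda>x (i, j). if (i, j) \<in> ?P then x i - x (M + j) else (0::real)"
  interpret grid_poset ?P by (rule grid_poset_rectangle)
  have "fun_space.dim (A_T ?P) = card ?K"
  proof (rule dim_A_T_eq_card[where D = ?D and E = ?E])
    fix x :: "int \<Rightarrow> real"
    assume supp: "\<forall>k. k \<notin> ?K \<longrightarrow> x k = 0"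
    then have ends: "x 0 = 0" "x (M + N) = 0" by auto
    show "balanced (?D x) (?E x) (\<lambda>_. 0)"
    proof (rule balancedI)
      fix i j assume p: "(i, j) \<in> ?P"
      \<comment> \<open>Each side contributes a value of \<open>u\<close>, here at
        \<open>(i, j + 1)\<close>, whether or not the neighbours lie in \<open>P\<close>. The
        equation for \<open>c = 0\<close> then says that the mixed second difference of
        \<open>u\<close> vanishes.\<close>
      have nw: "?D x (i, j + 1) + (if (i - 1, j + 1) \<in> ?P then 0 else ?E x (i - 1, j)) = x (i - 1) - x (M + j)"
      proof (cases "i = 1 \<and> j = N")
        case True
        then show ?thesis using ends by (simp add: P)
      qed (use p in \<open>auto simp: P\<close>)
      have se: "?D x (i + 1, j) + (if (i + 1, j - 1) \<in> ?P then 0 else ?E x (i, j - 1)) = x i - x (M + j - 1)"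
      proof (cases "i = M \<and> j = 1")
        case True
        then show ?thesis by (simp add: P)
      qed (use p in \<open>auto simp: P algebra_simps\<close>)
      show "0 = ?D x (i, j + 1) + (if (i - 1, j + 1) \<in> ?P then 0 else ?E x (i - 1, j))
        + ?D x (i + 1, j) + (if (i + 1, j - 1) \<in> ?P then 0 else ?E x (i, j - 1)) - ?D x (i, j) - ?E x (i, j)"
        using nw se p by simp
    qed (auto simp: P algebra_simps)
  next
    fix d e
    assume bal: "balanced d e (\<lambda>_. 0)"
      and supp: "\<forall>q. q \<notin> ?P \<longrightarrow> d q = 0" "\<forall>q. q \<notin> ?P \<longrightarrow> e q = 0"
    text \<open>By balancedness \<open>e (i, j) = d (i + 1, j + 1)\<close>, so \<open>d\<close> and \<open>e\<close> are restrictions of one function.\<close>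
    define u where "u = (\<lambda>(i, j). if (i, j) \<in> ?P then d (i, j) else e (i - 1, j - 1))"
    have d: "d (i, j) = u (i, j)" if "(i, j) \<in> ?P" for i j
      using that by (simp add: u_def)
    have e: "e (i, j) = u (i + 1, j + 1)" if "(i, j) \<in> ?P" for i j
      using balancedD(1)[OF bal, of "i + 1" j] that by (auto simp: u_def P)
    \<comment> \<open>The shifted points \<open>(0, N)\<close> and \<open>(M, 0)\<close> lie outside
      \<open>P\<close>, where \<open>e\<close> vanishes.\<close>
    have corners: "u (1, N + 1) = 0" "u (M + 1, 1) = 0"
      using supp(2) by (auto simp: u_def P)
    have eq: "u (i + 1, j + 1) + u (i, j) = u (i, j + 1) + u (i + 1, j)"
      if "1 \<le> i" "i \<le> M" "1 \<le> j" "j \<le> N" for i j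
    proof -
      have p: "(i, j) \<in> ?P" using that by (simp add: P)
      have "d (i, j + 1) + (if (i - 1, j + 1) \<in> ?P then 0 else e (i - 1, j)) = u (i, j + 1)"
        using supp that by (auto simp: u_def P)
      moreover have "d (i + 1, j) + (if (i + 1, j - 1) \<in> ?P then 0 else e (i, j - 1)) = u (i + 1, j)"
        using supp that by (auto simp: u_def P)
      ultimately show ?thesis
        using balancedD(3)[OF bal p] d[OF p] e[OF p] by simp
    qed
    have u: "u (i, j) = u (i, N + 1) + u (1, j)" if "1 \<le> i" "i \<le> M + 1" "1 \<le> j" "j \<le> N + 1" for i j
      using grid_additive[of M N u, OF eq that] corners by simp
    define x where "x k = (if k \<notin> ?K then 0 else if k \<le> M then u (k + 1, N + 1) else - u (1, k - M + 1))" for k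
    have x: "x (i - 1) = u (i, N + 1)" if "1 \<le> i" "i \<le> M + 1" for i
      using that corners MN by (cases "i = 1") (auto simp: x_def)
    \<comment> \<open>At \<open>j = 1\<close> the two readings of \<open>x M\<close> must agree:
      \<open>u (M + 1, N + 1) = - u (1, 1)\<close> follows from the splitting at the corner
      \<open>(M + 1, 1)\<close>.\<close>
    have x': "x (M + j - 1) = - u (1, j)" if "1 \<le> j" "j \<le> N + 1" for j
    proof -
      have "j = 1 \<or> j = N + 1 \<or> 2 \<le> j \<and> j \<le> N" using that by auto
      then show ?thesis
        using u[of "M + 1" 1] corners MN by (auto simp: x_def algebra_simps)
    qed
    show "\<exists>x. (\<forall>k. k \<notin> ?K \<longrightarrow> x k = 0) \<and> (\<forall>q\<in>?P. d q = ?D x q \<and> e q = ?E x q)"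
    proof (intro exI[of _ x] conjI ballI)
      fix q assume q: "q \<in> ?P"
      obtain i j where ij: "q = (i, j)" by (cases q)
      have le: "1 \<le> i" "i \<le> M" "1 \<le> j" "j \<le> N" using q by (auto simp: ij P)
      show "d q = ?D x q"
        using q d[of i j] u[of i j] x[of i] x'[of j] le by (simp add: ij)
      show "e q = ?E x q"
        using q e[of i j] u[of "i + 1" "j + 1"] x[of "i + 1"] x'[of "j + 1"] le by (simp add: ij algebra_simps)
    qed (auto simp: x_def)
  next
    fix x :: "int \<Rightarrow> real"
    assume supp: "\<forall>k. k \<notin> ?K \<longrightarrow> x k = 0" and 0: "\<forall>q\<in>?P. ?D x q = 0 \<and> ?E x q = 0"
    have "x k = 0" if "k \<in> ?K" for k
    proof (cases "k \<le> M")
      case True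
      then have "x k = x (M + N)" using bspec[OF 0, of "(k, N)"] that MN by (simp add: P)
      then show ?thesis using supp by simp
    next
      case False
      then have "x 0 = x k" using bspec[OF 0, of "(1, k - M + 1)"] that MN by (simp add: P)
      then show ?thesis using supp by simp
    qed
    then show "x = (\<lambda>_. 0)" using supp by blast
  qed (auto simp: algebra_simps split: if_splits)
  then show ?thesis using assms by (simp add: M_def N_def)
qed

text \<open>The diagonal values provide the splitting:
  \<open>u (i, j) = d (i, i) + e (j - 1, j - 1)\<close> for \<open>i < j\<close>. The sequence
  \<open>x\<close> lists \<open>d (N, N)\<close> down to \<open>d (1, 1)\<close> and then
  \<open>- e (N - 1, N - 1)\<close> up to \<open>- e (1, 1)\<close>. The corner
  \<open>(1, N + 1)\<close> gives \<open>d (1, 1) = - e (N, N)\<close>, so \<open>x N\<close> serves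
  both parts.\<close>

lemma dim_A_T_shifted_staircase:
  assumes "n \<ge> 2"
  shows "int (fun_space.dim (A_T (shifted_staircase n))) = 2 * int n - 1"
proof -
  let ?P = "shifted_staircase n"
  define N where "N = int n"
  have N: "N \<ge> 2" using assms by (auto simp: N_def)
  have P: "(i, j) \<in> ?P \<longleftrightarrow> 1 \<le> i \<and> i \<le> j \<and> j \<le> N" for i j
    by (simp add: shifted_staircase_def N_def)
  let ?K = "{1..2 * N - 1}"
  let ?D = "\<lambda>x (i, j). if (i, j) \<in> ?P then
    if i < j then x (N + 1 - i) - x (2 * N + 1 - j) else x (N + 1 - i) else (0::real)"
  let ?E = "\<lambda>x (i, j). if (i, j) \<in> ?P then
    if i < j then x (N - i) - x (2 * N - j) else - x (2 * N - i) else (0::real)"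
  interpret grid_poset ?P by (rule grid_poset_shifted_staircase)
  have "fun_space.dim (A_T ?P) = card ?K"
  proof (rule dim_A_T_eq_card[where D = ?D and E = ?E])
    fix x :: "int \<Rightarrow> real"
    assume supp: "\<forall>k. k \<notin> ?K \<longrightarrow> x k = 0"
    show "balanced (?D x) (?E x) (\<lambda>_. 0)"
    proof (rule balancedI)
      fix i j assume p: "(i, j) \<in> ?P"
      have nw: "?D x (i, j + 1) + (if (i - 1, j + 1) \<in> ?P then 0 else ?E x (i - 1, j))
          = x (N + 1 - i) - x (2 * N - j)"
      proof (cases "i = 1 \<and> j = N")
        case True
        then show ?thesis by (simp add: P)
      qed (use p in \<open>auto simp: P algebra_simps\<close>)
      have se: "?D x (i + 1, j) + (if (i + 1, j - 1) \<in> ?P then 0 else ?E x (i, j - 1))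
          = (if i < j then x (N - i) - x (2 * N + 1 - j) else 0)"
      proof -
        consider "j = i" | "j = i + 1" | "i + 2 \<le> j" using p by (force simp: P)
        then show ?thesis
          by cases (use p in \<open>auto simp: P algebra_simps\<close>)
      qed
      show "0 = ?D x (i, j + 1) + (if (i - 1, j + 1) \<in> ?P then 0 else ?E x (i - 1, j))
        + ?D x (i + 1, j) + (if (i + 1, j - 1) \<in> ?P then 0 else ?E x (i, j - 1)) - ?D x (i, j) - ?E x (i, j)"
        using nw se p by (cases "i = j") (auto simp: P)
    qed (auto simp: P algebra_simps)
  next
    fix d e
    assume bal: "balanced d e (\<lambda>_. 0)"
      and supp: "\<forall>q. q \<notin> ?P \<longrightarrow> d q = 0" "\<forall>q. q \<notin> ?P \<longrightarrow> e q = 0"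
    define u where "u = (\<lambda>(i, j). if (i, j) \<in> ?P then d (i, j) else e (i - 1, j - 1))"
    have d: "d (i, j) = u (i, j)" if "(i, j) \<in> ?P" for i j
      using that by (simp add: u_def)
    have e: "e (i, j) = u (i + 1, j + 1)" if "(i, j) \<in> ?P" "i < j" for i j
      using balancedD(1)[OF bal, of "i + 1" j] that by (auto simp: u_def P)
    have nw: "d (i, j + 1) + (if (i - 1, j + 1) \<in> ?P then 0 else e (i - 1, j)) = u (i, j + 1)"
      if "(i, j) \<in> ?P" for i j
      using supp that by (auto simp: u_def P)
    have eq: "u (i + 1, j + 1) + u (i, j) = u (i, j + 1) + u (i + 1, j)"
      if p: "(i, j) \<in> ?P" "i + 2 \<le> j" for i j
    proof -
      have "(i + 1, j) \<in> ?P" "(i + 1, j - 1) \<in> ?P" using p by (auto simp: P)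
      then show ?thesis
        using balancedD(3)[OF bal p(1)] nw[OF p(1)] d p e[of i j] by simp
    qed
    \<comment> \<open>At \<open>(i, i + 1)\<close> the side neighbour \<open>(i + 1, i)\<close> is
      missing, so \<open>d (i + 1, i + 1)\<close> and \<open>e (i, i)\<close> both enter in place of
      a single value of \<open>u\<close>.\<close>
    have eq1: "u (i + 1, i + 2) + u (i, i + 1) = u (i, i + 2) + d (i + 1, i + 1) + e (i, i)"
      if "1 \<le> i" "i < N" for i
    proof -
      have p: "(i, i + 1) \<in> ?P" "(i + 1, i) \<notin> ?P" using that by (auto simp: P)
      have "i + 2 = i + 1 + 1" by simp
      then show ?thesis
        using balancedD(3)[OF bal p(1)] nw[OF p(1)] d[OF p(1)] e[OF p(1)] p(2)
        by (simp add: algebra_simps)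
    qed
    have eq0: "u (i, i + 1) = d (i, i) + e (i, i)" if "1 \<le> i" "i \<le> N" for i
    proof -
      have p: "(i, i) \<in> ?P" using that by (auto simp: P)
      have "(i + 1, i) \<notin> ?P" "(i, i - 1) \<notin> ?P" "(i + 1, i - 1) \<notin> ?P" by (auto simp: P)
      then show ?thesis
        using balancedD(3)[OF bal p] nw[OF p] supp by simp
    qed
    \<comment> \<open>Induction on the distance from the main diagonal: \<open>eq0\<close> and
      \<open>eq1\<close> settle the distances one and two, \<open>eq\<close> the larger
      ones.\<close>
    have u: "u (i, j) = d (i, i) + e (j - 1, j - 1)" if "1 \<le> i" "i < j" "j \<le> N + 1" for i j
      using that
    proof (induction "nat (j - i)" arbitrary: i j rule: less_induct)
      case less
      consider "j = i + 1" | "j = i + 2" | "i + 3 \<le> j" using less.prems by linarith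
      then show ?case
      proof cases
        case 1
        then show ?thesis using eq0[of i] less.prems by simp
      next
        case 2
        then show ?thesis
          using eq1[of i] eq0[of i] eq0[of "i + 1"] less.prems by (simp add: algebra_simps)
      next
        case 3
        have "u (i + 1, j - 1 + 1) + u (i, j - 1) = u (i, j - 1 + 1) + u (i + 1, j - 1)"
          by (rule eq) (use less.prems 3 in \<open>auto simp: P\<close>)
        moreover have "u (i + 1, j) = d (i + 1, i + 1) + e (j - 1, j - 1)"
          by (rule less.hyps) (use less.prems 3 in auto)
        moreover have "u (i, j - 1) = d (i, i) + e (j - 1 - 1, j - 1 - 1)"
          by (rule less.hyps) (use less.prems 3 in auto)
        moreover have "u (i + 1, j - 1) = d (i + 1, i + 1) + e (j - 1 - 1, j - 1 - 1)"
          by (rule less.hyps) (use less.prems 3 in auto)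
        ultimately show ?thesis by simp
      qed
    qed
    have "u (1, N + 1) = 0" using supp(2) by (auto simp: u_def P)
    then have corner: "d (1, 1) = - e (N, N)" using u[of 1 "N + 1"] N by simp
    define x where "x k = (if k \<notin> ?K then 0 else if k \<le> N then d (N + 1 - k, N + 1 - k)
      else - e (2 * N - k, 2 * N - k))" for k
    have x: "x (N + 1 - i) = d (i, i)" if "1 \<le> i" "i \<le> N" for i
      using that N by (simp add: x_def)
    have x': "x (2 * N - i) = - e (i, i)" if "1 \<le> i" "i \<le> N" for i
      using that N corner by (cases "i = N") (auto simp: x_def)
    show "\<exists>x. (\<forall>k. k \<notin> ?K \<longrightarrow> x k = 0) \<and> (\<forall>q\<in>?P. d q = ?D x q \<and> e q = ?E x q)"
    proof (intro exI[of _ x] conjI ballI)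
      fix q assume q: "q \<in> ?P"
      obtain i j where ij: "q = (i, j)" by (cases q)
      have le: "1 \<le> i" "i \<le> j" "j \<le> N" using q by (auto simp: ij P)
      show "d q = ?D x q"
        using q d[of i j] u[of i j] x[of i] x'[of "j - 1"] le by (auto simp: ij algebra_simps)
      show "e q = ?E x q"
        using q e[of i j] u[of "i + 1" "j + 1"] x[of "i + 1"] x'[of j] le
        by (cases "i = j") (auto simp: ij algebra_simps)
    qed (auto simp: x_def)
  next
    fix x :: "int \<Rightarrow> real"
    assume supp: "\<forall>k. k \<notin> ?K \<longrightarrow> x k = 0" and 0: "\<forall>q\<in>?P. ?D x q = 0 \<and> ?E x q = 0"
    have "x k = 0" if "k \<in> ?K" for k
      using bspec[OF 0, of "(N + 1 - k, N + 1 - k)"] bspec[OF 0, of "(2 * N - k, 2 * N - k)"] that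
      by (cases "k \<le> N") (auto simp: P)
    then show "x = (\<lambda>_. 0)" using supp by blast
  qed (auto simp: algebra_simps split: if_splits)
  then show ?thesis using assms by (simp add: N_def)
qed

text \<open>Squares without bottom force \<open>u\<close> to vanish on the level
  \<open>i + j = N + 2\<close>. So the two parts of the splitting mirror each other, and both are
  described by one sequence \<open>x\<close>, normalized by \<open>x 0 = 0\<close>.\<close>

lemma dim_A_T_root_poset_A:
  "int (fun_space.dim (A_T (root_poset_A n))) = int n"
proof -
  let ?P = "root_poset_A n"
  define N where "N = int n"
  have P: "(i, j) \<in> ?P \<longleftrightarrow> 1 \<le> i \<and> i \<le> N \<and> 1 \<le> j \<and> j \<le> N \<and> N + 1 \<le> i + j" for i j
    by (simp add: root_poset_A_def N_def)
  let ?K = "{1..N}"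
  let ?D = "\<lambda>x (i, j). if (i, j) \<in> ?P then x (i - 1) - x (N + 1 - j) else (0::real)"
  let ?E = "\<lambda>x (i, j). if (i, j) \<in> ?P then x i - x (N - j) else (0::real)"
  interpret grid_poset ?P by (rule grid_poset_root_poset_A)
  have "fun_space.dim (A_T ?P) = card ?K"
  proof (rule dim_A_T_eq_card[where D = ?D and E = ?E])
    fix x :: "int \<Rightarrow> real"
    assume supp: "\<forall>k. k \<notin> ?K \<longrightarrow> x k = 0"
    \<comment> \<open>On the level \<open>N + 2\<close> the two terms cancel, so the formula
      persists at points outside \<open>P\<close>; the same holds for \<open>?E\<close> on the level
      \<open>N\<close>.\<close>
    have D: "?D x (i, j) = x (i - 1) - x (N + 1 - j)" if "(i, j) \<in> ?P \<or> i + j = N + 2" for i j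
    proof (cases "i + j = N + 2")
      case True
      then have "i - 1 = N + 1 - j" by simp
      then show ?thesis by (simp only: prod.case diff_self if_cancel)
    qed (use that in simp)
    have E: "?E x (i, j) = x i - x (N - j)" if "(i, j) \<in> ?P \<or> i + j = N" for i j
    proof (cases "i + j = N")
      case True
      then have "i = N - j" by simp
      then show ?thesis by (simp only: prod.case diff_self if_cancel)
    qed (use that in simp)
    show "balanced (?D x) (?E x) (\<lambda>_. 0)"
    proof (rule balancedI)
      fix i j assume p: "(i, j) \<in> ?P" "(i - 1, j + 1) \<in> ?P"
      show "?D x (i, j + 1) = ?E x (i - 1, j)"
        using D[of i "j + 1"] E[of "i - 1" j] p by (force simp: P)
    next
      fix i j assume p: "(i, j) \<in> ?P" "(i + 1, j - 1) \<in> ?P"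
      show "?D x (i + 1, j) = ?E x (i, j - 1)"
        using D[of "i + 1" j] E[of i "j - 1"] p by (force simp: P algebra_simps)
    next
      fix i j assume p: "(i, j) \<in> ?P"
      have nw: "?D x (i, j + 1) + (if (i - 1, j + 1) \<in> ?P then 0 else ?E x (i - 1, j)) = x (i - 1) - x (N - j)"
      proof (cases "(i - 1, j + 1) \<in> ?P")
        case True
        then show ?thesis using D[of i "j + 1"] p by (force simp: P)
      next
        case False
        then show ?thesis using E[of "i - 1" j] p supp by (force simp: P)
      qed
      have se: "?D x (i + 1, j) + (if (i + 1, j - 1) \<in> ?P then 0 else ?E x (i, j - 1)) = x i - x (N + 1 - j)"
      proof (cases "(i + 1, j - 1) \<in> ?P")
        case True
        then show ?thesis using D[of "i + 1" j] p by (force simp: P)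
      next
        case False
        then show ?thesis using E[of i "j - 1"] p supp by (force simp: P algebra_simps)
      qed
      show "0 = ?D x (i, j + 1) + (if (i - 1, j + 1) \<in> ?P then 0 else ?E x (i - 1, j))
        + ?D x (i + 1, j) + (if (i + 1, j - 1) \<in> ?P then 0 else ?E x (i, j - 1)) - ?D x (i, j) - ?E x (i, j)"
        using nw se p by simp
    qed
  next
    fix d e
    assume bal: "balanced d e (\<lambda>_. 0)"
      and supp: "\<forall>q. q \<notin> ?P \<longrightarrow> d q = 0" "\<forall>q. q \<notin> ?P \<longrightarrow> e q = 0"
    define u where "u = (\<lambda>(i, j). if (i, j) \<in> ?P then d (i, j) else e (i - 1, j - 1))"
    have d: "d (i, j) = u (i, j)" if "(i, j) \<in> ?P" for i j
      using that by (simp add: u_def)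
    have e: "e (i, j) = u (i + 1, j + 1)" if "(i, j) \<in> ?P" for i j
      using balancedD(1)[OF bal, of "i + 1" j] that by (auto simp: u_def P)
    have eq: "u (i + 1, j + 1) + u (i, j) = u (i, j + 1) + u (i + 1, j)" if p: "(i, j) \<in> ?P" for i j
    proof -
      have "d (i, j + 1) + (if (i - 1, j + 1) \<in> ?P then 0 else e (i - 1, j)) = u (i, j + 1)"
        using supp that by (auto simp: u_def P)
      moreover have "d (i + 1, j) + (if (i + 1, j - 1) \<in> ?P then 0 else e (i, j - 1)) = u (i + 1, j)"
        using supp that by (auto simp: u_def P)
      ultimately show ?thesis
        using balancedD(3)[OF bal p] d[OF p] e[OF p] by simp
    qed
    have rank1: "u (i, j) = 0" if "1 \<le> i" "1 \<le> j" "i + j = N + 2" for i j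
    proof (cases "(i, j) \<in> ?P")
      case True
      then have "d (i, j - 1 + 1) = e (i - 1, j - 1)"
        using that by (intro balancedD(1)[OF bal]) (auto simp: P)
      then show ?thesis using True supp(2) that by (simp add: u_def P)
    qed (use supp(2) that in \<open>auto simp: u_def P\<close>)
    \<comment> \<open>These partial sums solve \<open>x (i - 1) - x i = d (i, N + 1 - i)\<close>,
      the formula for \<open>u\<close> in rank zero.\<close>
    define x where "x k = (if k \<notin> ?K then 0 else - (\<Sum>l = 1..k. d (l, N + 1 - l)))" for k
    have x: "x (i - 1) - x i = d (i, N + 1 - i)" if "1 \<le> i" "i \<le> N" for i
    proof -
      have "{1..i} = insert i {1..i - 1}" using that by auto
      then show ?thesis using that by (auto simp: x_def)
    qed
    \<comment> \<open>The levels \<open>N + 1\<close> and \<open>N + 2\<close> are initial data;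
      \<open>eq\<close> determines the higher levels.\<close>
    have u: "u (i, j) = x (i - 1) - x (N + 1 - j)"
      if "1 \<le> i" "i \<le> N + 1" "1 \<le> j" "j \<le> N + 1" "N + 1 \<le> i + j" for i j
      using that
    proof (induction "nat (i + j)" arbitrary: i j rule: less_induct)
      case less
      consider "j = N + 1 - i" | "i + j = N + 2" | "N + 3 \<le> i + j" using less.prems by linarith
      then show ?case
      proof cases
        case 1
        then show ?thesis using x[of i] d[of i j] less.prems by (auto simp: P)
      next
        case 2
        then have "i - 1 = N + 1 - j" by simp
        then show ?thesis using rank1[of i j] 2 less.prems by (simp only: diff_self)
      next
        case 3
        have "u (i - 1 + 1, j - 1 + 1) + u (i - 1, j - 1) = u (i - 1, j - 1 + 1) + u (i - 1 + 1, j - 1)"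
          by (rule eq) (use less.prems 3 in \<open>auto simp: P\<close>)
        moreover have "u (i - 1, j) = x (i - 1 - 1) - x (N + 1 - j)"
          by (rule less.hyps) (use less.prems 3 in auto)
        moreover have "u (i, j - 1) = x (i - 1) - x (N + 1 - (j - 1))"
          by (rule less.hyps) (use less.prems 3 in auto)
        moreover have "u (i - 1, j - 1) = x (i - 1 - 1) - x (N + 1 - (j - 1))"
          by (rule less.hyps) (use less.prems 3 in auto)
        ultimately show ?thesis by simp
      qed
    qed
    show "\<exists>x. (\<forall>k. k \<notin> ?K \<longrightarrow> x k = 0) \<and> (\<forall>q\<in>?P. d q = ?D x q \<and> e q = ?E x q)"
    proof (intro exI[of _ x] conjI ballI)
      fix q assume q: "q \<in> ?P"
      obtain i j where ij: "q = (i, j)" by (cases q)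
      have le: "1 \<le> i" "i \<le> N" "1 \<le> j" "j \<le> N" "N + 1 \<le> i + j" using q by (auto simp: ij P)
      show "d q = ?D x q"
        using q d[of i j] u[of i j] le by (simp add: ij)
      show "e q = ?E x q"
        using q e[of i j] u[of "i + 1" "j + 1"] le by (simp add: ij)
    qed (auto simp: x_def)
  next
    fix x :: "int \<Rightarrow> real"
    assume supp: "\<forall>k. k \<notin> ?K \<longrightarrow> x k = 0" and 0: "\<forall>q\<in>?P. ?D x q = 0 \<and> ?E x q = 0"
    have "x k = 0" if "k \<in> ?K" for k
    proof -
      have "x (l + 1) = x l" if "0 \<le> l" "l < N" for l
        using bspec[OF 0, of "(l + 1, N - l)"] that by (simp add: P)
      then have "x k = x 0"
        using that by (intro interval_constant[of 0 N]) auto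
      then show ?thesis using supp by simp
    qed
    then show "x = (\<lambda>_. 0)" using supp by blast
  qed (auto simp: algebra_simps split: if_splits)
  then show ?thesis by (simp add: N_def)
qed

text \<open>Both effects combine: separate values of \<open>d\<close> and \<open>e\<close> on
  \<open>i = j\<close>, and \<open>u = 0\<close> on the level \<open>i + j = 2 * N + 1\<close>.
  Together they give \<open>e (N, N) = - d (N, N)\<close>, which glues the diagonal values of
  \<open>e\<close>, for indices up to \<open>N\<close>, and of \<open>- d\<close>, from
  \<open>N\<close> on, into one sequence.\<close>

lemma dim_A_T_root_poset_B:
  assumes "n \<ge> 2"
  shows "int (fun_space.dim (A_T (root_poset_B n))) = 2 * int n - 1"
proof -
  let ?P = "root_poset_B n"
  define N where "N = int n"
  have N: "N \<ge> 2" using assms by (auto simp: N_def)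
  have P: "(i, j) \<in> ?P \<longleftrightarrow> 1 \<le> j \<and> j \<le> i \<and> i \<le> 2 * N - 1 \<and> 2 * N \<le> i + j" for i j
    by (simp add: root_poset_B_def N_def)
  let ?K = "{1..2 * N - 1}"
  let ?D = "\<lambda>x (i, j). if (i, j) \<in> ?P then
    if j < i then x (2 * N + 1 - i) - x j else - x i else (0::real)"
  let ?E = "\<lambda>x (i, j). if (i, j) \<in> ?P then
    if j < i then x (2 * N - i) - x (j + 1) else x (2 * N - i) else (0::real)"
  interpret grid_poset ?P by (rule grid_poset_root_poset_B)
  have "fun_space.dim (A_T ?P) = card ?K"
  proof (rule dim_A_T_eq_card[where D = ?D and E = ?E])
    fix x :: "int \<Rightarrow> real"
    assume supp: "\<forall>k. k \<notin> ?K \<longrightarrow> x k = 0"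
    have D: "?D x (i, j) = x (2 * N + 1 - i) - x j"
      if "(i, j) \<in> ?P \<or> i + j = 2 * N + 1" "j < i" for i j
    proof (cases "i + j = 2 * N + 1")
      case True
      then have "j = 2 * N + 1 - i" by simp
      then show ?thesis using that(2) by (simp only: prod.case diff_self if_cancel if_True)
    qed (use that in simp)
    have E: "?E x (i, j) = x (2 * N - i) - x (j + 1)"
      if "(i, j) \<in> ?P \<or> i + j = 2 * N - 1" "j < i" for i j
    proof (cases "i + j = 2 * N - 1")
      case True
      then have "j + 1 = 2 * N - i" by simp
      then show ?thesis using that(2) by (simp only: prod.case diff_self if_cancel if_True)
    qed (use that in simp)
    show "balanced (?D x) (?E x) (\<lambda>_. 0)"
    proof (rule balancedI)
      fix i j assume p: "(i, j) \<in> ?P" "(i - 1, j + 1) \<in> ?P"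
      show "?D x (i, j + 1) = ?E x (i - 1, j)"
      proof -
        have "?D x (i, j + 1) = x (2 * N + 1 - i) - x (j + 1)"
          by (rule D) (use p in \<open>auto simp: P\<close>)
        moreover have "?E x (i - 1, j) = x (2 * N - (i - 1)) - x (j + 1)"
          by (rule E) (use p in \<open>auto simp: P\<close>)
        moreover have "2 * N - (i - 1) = 2 * N + 1 - i" by simp
        ultimately show ?thesis by (simp only:)
      qed
    next
      fix i j assume p: "(i, j) \<in> ?P" "(i + 1, j - 1) \<in> ?P"
      show "?D x (i + 1, j) = ?E x (i, j - 1)"
      proof -
        have "?D x (i + 1, j) = x (2 * N + 1 - (i + 1)) - x j"
          by (rule D) (use p in \<open>auto simp: P\<close>)
        moreover have "?E x (i, j - 1) = x (2 * N - i) - x (j - 1 + 1)"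
          by (rule E) (use p in \<open>auto simp: P\<close>)
        moreover have "2 * N + 1 - (i + 1) = 2 * N - i" "j - 1 + 1 = j" by simp_all
        ultimately show ?thesis by (simp only:)
      qed
    next
      fix i j assume p: "(i, j) \<in> ?P"
      have nw: "?D x (i, j + 1) + (if (i - 1, j + 1) \<in> ?P then 0 else ?E x (i - 1, j))
          = (if j < i then x (2 * N + 1 - i) - x (j + 1) else 0)"
      proof -
        consider "i = j" | "i = j + 1" | "j + 2 \<le> i" using p by (force simp: P)
        then show ?thesis
        proof cases
          case 3
          then show ?thesis using D[of i "j + 1"] p by (force simp: P)
        qed (use p in \<open>auto simp: P\<close>)
      qed
      have se: "?D x (i + 1, j) + (if (i + 1, j - 1) \<in> ?P then 0 else ?E x (i, j - 1)) = x (2 * N - i) - x j"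
      proof (cases "(i + 1, j - 1) \<in> ?P")
        case True
        then show ?thesis using D[of "i + 1" j] p by (force simp: P)
      next
        case False
        then show ?thesis using E[of i "j - 1"] p supp by (force simp: P algebra_simps)
      qed
      show "0 = ?D x (i, j + 1) + (if (i - 1, j + 1) \<in> ?P then 0 else ?E x (i - 1, j))
        + ?D x (i + 1, j) + (if (i + 1, j - 1) \<in> ?P then 0 else ?E x (i, j - 1)) - ?D x (i, j) - ?E x (i, j)"
        using nw se p by (cases "i = j") (auto simp: P)
    qed
  next
    fix d e
    assume bal: "balanced d e (\<lambda>_. 0)"
      and supp: "\<forall>q. q \<notin> ?P \<longrightarrow> d q = 0" "\<forall>q. q \<notin> ?P \<longrightarrow> e q = 0"
    define u where "u = (\<lambda>(i, j). if (i, j) \<in> ?P then d (i, j) else e (i - 1, j - 1))"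
    have d: "d (i, j) = u (i, j)" if "(i, j) \<in> ?P" for i j
      using that by (simp add: u_def)
    have e: "e (i, j) = u (i + 1, j + 1)" if "(i, j) \<in> ?P" "j < i" for i j
      using balancedD(2)[OF bal, of i "j + 1"] that by (auto simp: u_def P)
    have se: "d (i + 1, j) + (if (i + 1, j - 1) \<in> ?P then 0 else e (i, j - 1)) = u (i + 1, j)"
      if "(i, j) \<in> ?P" for i j
      using supp that by (auto simp: u_def P)
    have eq: "u (i + 1, j + 1) + u (i, j) = u (i, j + 1) + u (i + 1, j)"
      if p: "(i, j) \<in> ?P" "j + 2 \<le> i" for i j
    proof -
      have "(i, j + 1) \<in> ?P" "(i - 1, j + 1) \<in> ?P" using p by (auto simp: P)
      then show ?thesis
        using balancedD(3)[OF bal p(1)] se[OF p(1)] d p e[of i j] by simp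
    qed
    have eq1: "u (j + 2, j + 1) + u (j + 1, j) = d (j + 1, j + 1) + e (j, j) + u (j + 2, j)"
      if "N \<le> j" "j < 2 * N - 1" for j
    proof -
      have p: "(j + 1, j) \<in> ?P" "(j, j + 1) \<notin> ?P" using that N by (auto simp: P)
      have "j + 2 = j + 1 + 1" by simp
      then show ?thesis
        using balancedD(3)[OF bal p(1)] se[OF p(1)] d[OF p(1)] e[OF p(1)] p(2)
        by (simp add: algebra_simps)
    qed
    have eq0: "u (j + 1, j) = d (j, j) + e (j, j)" if "N \<le> j" "j \<le> 2 * N - 1" for j
    proof -
      have p: "(j, j) \<in> ?P" using that N by (auto simp: P)
      have "(j, j + 1) \<notin> ?P" "(j - 1, j) \<notin> ?P" "(j - 1, j + 1) \<notin> ?P" by (auto simp: P)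
      then show ?thesis
        using balancedD(3)[OF bal p] se[OF p] supp by simp
    qed
    have rank1: "u (i, j) = 0" if "1 \<le> j" "j < i" "i + j = 2 * N + 1" for i j
    proof (cases "(i, j) \<in> ?P")
      case True
      then have "d (i, j - 1 + 1) = e (i - 1, j - 1)"
        using that by (intro balancedD(1)[OF bal]) (auto simp: P)
      then show ?thesis using True supp(2) that by (simp add: u_def P)
    qed (use supp(2) that in \<open>auto simp: u_def P\<close>)
    have corner: "e (N, N) = - d (N, N)" using eq0[of N] rank1[of N "N + 1"] N by simp
    define x where "x k = (if k \<notin> ?K then 0 else if k < N then e (2 * N - k, 2 * N - k) else - d (k, k))" for k
    have x: "d (j, j) = - x j" if "N \<le> j" "j \<le> 2 * N - 1" for j
      using that N by (simp add: x_def)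
    have x': "e (j, j) = x (2 * N - j)" if "N \<le> j" "j \<le> 2 * N - 1" for j
      using that N corner by (cases "j = N") (auto simp: x_def)
    \<comment> \<open>Induction away from the diagonal, above rank zero; the base cases are the
      zeros on the level \<open>2 * N + 1\<close> and the distances one and two.\<close>
    have u': "u (i, j) = x (2 * N + 1 - i) - x j"
      if "1 \<le> j" "j < i" "i \<le> 2 * N" "2 * N + 1 \<le> i + j" for i j
      using that
    proof (induction "nat (i - j)" arbitrary: i j rule: less_induct)
      case less
      consider "i + j = 2 * N + 1" | "i = j + 1" | "i = j + 2" | "j + 3 \<le> i" "2 * N + 2 \<le> i + j"
        using less.prems by linarith
      then show ?case
      proof cases
        case 1
        then have "j = 2 * N + 1 - i" by simp
        then show ?thesis using rank1[of j i] 1 less.prems by (simp only: diff_self)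
      next
        case 2
        then show ?thesis using eq0[of j] x[of j] x'[of j] less.prems by simp
      next
        case 3
        then have "N \<le> j" "j < 2 * N - 1" using less.prems by auto
        then show ?thesis
          using eq1[of j] eq0[of j] eq0[of "j + 1"] x[of j] x'[of "j + 1"] 3 by (simp add: algebra_simps)
      next
        case 4
        have "u (i - 1 + 1, j + 1) + u (i - 1, j) = u (i - 1, j + 1) + u (i - 1 + 1, j)"
          by (rule eq) (use less.prems 4 in \<open>auto simp: P\<close>)
        moreover have "u (i, j + 1) = x (2 * N + 1 - i) - x (j + 1)"
          by (rule less.hyps) (use less.prems 4 in auto)
        moreover have "u (i - 1, j) = x (2 * N + 1 - (i - 1)) - x j"
          by (rule less.hyps) (use less.prems 4 in auto)
        moreover have "u (i - 1, j + 1) = x (2 * N + 1 - (i - 1)) - x (j + 1)"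
          by (rule less.hyps) (use less.prems 4 in auto)
        ultimately show ?thesis by simp
      qed
    qed
    \<comment> \<open>In rank zero, \<open>eq\<close> is solved for the bottom of the square whose
      other vertices are covered by \<open>u'\<close>.\<close>
    have u: "u (i, j) = x (2 * N + 1 - i) - x j"
      if "1 \<le> j" "j < i" "i \<le> 2 * N" "2 * N \<le> i + j" for i j
    proof (cases "i + j = 2 * N")
      case True
      then have "j + 2 \<le> i" using that by presburger
      moreover have "(i, j) \<in> ?P" using True that by (auto simp: P)
      ultimately show ?thesis
        using eq[of i j] u'[of "j + 1" "i + 1"] u'[of "j + 1" i] u'[of j "i + 1"] True that
        by (simp add: algebra_simps)
    qed (use u' that in simp)
    show "\<exists>x. (\<forall>k. k \<notin> ?K \<longrightarrow> x k = 0) \<and> (\<forall>q\<in>?P. d q = ?D x q \<and> e q = ?E x q)"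
    proof (intro exI[of _ x] conjI ballI)
      fix q assume q: "q \<in> ?P"
      obtain i j where ij: "q = (i, j)" by (cases q)
      have le: "1 \<le> j" "j \<le> i" "i \<le> 2 * N - 1" "2 * N \<le> i + j" using q by (auto simp: ij P)
      show "d q = ?D x q"
        using q d[of i j] u[of j i] x[of i] le by (cases "i = j") (auto simp: ij)
      show "e q = ?E x q"
        using q e[of i j] u[of "j + 1" "i + 1"] x'[of i] le by (cases "i = j") (auto simp: ij)
    qed (auto simp: x_def)
  next
    fix x :: "int \<Rightarrow> real"
    assume supp: "\<forall>k. k \<notin> ?K \<longrightarrow> x k = 0" and 0: "\<forall>q\<in>?P. ?D x q = 0 \<and> ?E x q = 0"
    have "x k = 0" if "k \<in> ?K" for k
      using bspec[OF 0, of "(k, k)"] bspec[OF 0, of "(2 * N - k, 2 * N - k)"] that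
      by (cases "k < N") (auto simp: P)
    then show "x = (\<lambda>_. 0)" using supp by blast
  qed (auto simp: algebra_simps split: if_splits)
  then show ?thesis using assms by (simp add: N_def)
qed

theorem theorem2p3:
  shows "(\<forall>m n :: nat. m \<ge> 2 \<and> n \<ge> 2 \<longrightarrow>
            int (fun_space.dim (I_T (rectangle m n))) = int (fun_space.dim (A_T (rectangle m n))) \<and>
            int (fun_space.dim (A_T (rectangle m n))) = poset_rank (rectangle m n) + 1 \<and>
            poset_rank (rectangle m n) + 1 = int n + int m - 1)
       \<and> (\<forall>n :: nat. n \<ge> 2 \<longrightarrow>
            int (fun_space.dim (I_T (shifted_staircase n))) = int (fun_space.dim (A_T (shifted_staircase n))) \<and>
            int (fun_space.dim (A_T (shifted_staircase n))) = poset_rank (shifted_staircase n) + 1 \<and>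
            poset_rank (shifted_staircase n) + 1 = 2 * int n - 1)
       \<and> (\<forall>n :: nat. n \<ge> 2 \<longrightarrow>
            int (fun_space.dim (I_T (root_poset_A n))) = int (fun_space.dim (A_T (root_poset_A n))) \<and>
            int (fun_space.dim (A_T (root_poset_A n))) = poset_rank (root_poset_A n) + 1 \<and>
            poset_rank (root_poset_A n) + 1 = int n)
       \<and> (\<forall>n :: nat. n \<ge> 2 \<longrightarrow>
            int (fun_space.dim (I_T (root_poset_B n))) = int (fun_space.dim (A_T (root_poset_B n))) \<and>
            int (fun_space.dim (A_T (root_poset_B n))) = poset_rank (root_poset_B n) + 1 \<and>
            poset_rank (root_poset_B n) + 1 = 2 * int n - 1)"
  using dim_I_T_rectangle dim_A_T_rectangle poset_rank_rectangle
    dim_I_T_shifted_staircase dim_A_T_shifted_staircase poset_rank_shifted_staircase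
    dim_I_T_root_poset_A dim_A_T_root_poset_A poset_rank_root_poset_A
    dim_I_T_root_poset_B dim_A_T_root_poset_B poset_rank_root_poset_B
  by simp

end
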